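(* Let $\mathcal{A}$ be a unital $C^{*}$-algebra, $\mathcal{H}$ a Hilbert $\mathcal{A}$-module and $I$ a countable index set. Let $\{\Lambda_{i}\}_{i\in I}$ be a $\ast$-operator frame for $End_{\mathcal{A}}^{*}(\mathcal{H})$ with $\ast$-operator frame transform $\theta$, $\ast$-frame operator $S$ and canonical dual $\ast$-operator frame $\{\tilde{\Lambda}_{i}\}_{i\in I}$. Let $\{\Omega_{i}\}_{i\in I}$ be an arbitrary dual $\ast$-operator frame of $\{\Lambda_{i}\}_{i\in I}$ with $\ast$-operator frame transform $\eta$. Then the following statements are true: (1) $\theta^{*}\eta=I$ (the identity of $\mathcal{H}$). (2) $\Omega_{i}=\Pi_{i}\eta$ for all $i\in I$. (3) If $\eta':\mathcal{H}\to l^{2}(\mathcal{H})$ is any adjointable right inverse of $\theta^{*}$ (i.e. $\theta^{*}\eta'=I$), then $\{\Pi_{i}\eta'\}_{i\in I}$ is a dual $\ast$-operator frame of $\{\Lambda_{i}\}_{i\in I}$ with $\ast$-operator frame transform $\eta'$. (4) The $\ast$-frame operator $S_{\Omega}$ of $\{\Omega_{i}\}_{i\in I}$ is equal to $S^{-1}+\eta^{*}(I-\theta S^{-1}\theta^{*})\eta$. (5) Every adjointable right inverse $\eta'$ of $\theta^{*}$ is of the form $\eta'=\theta S^{-1}+(I-\theta S^{-1}\theta^{*})\psi$ for some adjointable map $\psi:\mathcal{H}\to l^{2}(\mathcal{H})$, and conversely every map of this form is an adjointable right inverse of $\theta^{*}$. (6) There exists a $\ast$-operator Bessel sequence $\{\Delta_{i}\}_{i\in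 I}$ for $End_{\mathcal{A}}^{*}(\mathcal{H})$ whose $\ast$-operator frame transform is $\eta$ and which satisfies $$\Omega_{i}=\tilde{\Lambda}_{i}+\Delta_{i}-\sum_{k\in I}\tilde{\Lambda}_{i}\Lambda_{k}^{*}\Delta_{k}\quad\text{for all }i\in I.$$
   Context: Hilbert $C^{*}$-modules are left modules, with $\mathcal{A}$-valued inner product $\langle\cdot,\cdot\rangle_{\mathcal{A}}$ that is $\mathcal{A}$-linear in the first variable. $End_{\mathcal{A}}^{*}(\mathcal{H})$ denotes the $C^{*}$-algebra of adjointable operators $\mathcal{H}\to\mathcal{H}$. An element $a\in\mathcal{A}$ is strictly nonzero if $0$ is not in its spectrum, i.e. $a$ is invertible. $\ast$-operator frame: a family $\{T_{i}\}_{i\in I}\subset End_{\mathcal{A}}^{*}(\mathcal{H})$ is a $\ast$-operator frame for $End_{\mathcal{A}}^{*}(\mathcal{H})$ if there exist strictly nonzero $A,B\in\mathcal{A}$ such that $$A\langle x,x\rangle_{\mathcal{A}}A^{*}\leq\sum_{i\in I}\langle T_{i}x,T_{i}x\rangle_{\mathcal{A}}\leq B\langle x,x\rangle_{\mathcal{A}}B^{*}\quad\text{for all }x\in\mathcal{H},$$ where the series in the middle converges in the norm of $\mathcal{A}$. If only the upper inequality is required (with the series norm-convergent), $\{T_{i}\}_{i\in I}$ is called a $\ast$-operator Bessel sequence. Series of vectors in $\mathcal{H}$ converge in the norm of $\mathcal{H}$, and series of operators converge pointwise (strongly) on $\mathcal{H}$. Dual: a $\ast$-operator frame $\{\Omega_{i}\}_{i\in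 I}$ is a dual $\ast$-operator frame of the $\ast$-operator frame $\{\Lambda_{i}\}_{i\in I}$ if $x=\sum_{i\in I}\Lambda_{i}^{*}\Omega_{i}x$ for all $x\in\mathcal{H}$. $l^{2}(\mathcal{H})$ is the Hilbert $\mathcal{A}$-module of families $(x_{i})_{i\in I}$ in $\mathcal{H}$ such that $\sum_{i\in I}\langle x_{i},x_{i}\rangle_{\mathcal{A}}$ converges in norm, with inner product $\sum_{i\in I}\langle x_{i},y_{i}\rangle_{\mathcal{A}}$. $\Pi_{i}:l^{2}(\mathcal{H})\to\mathcal{H}$ is the $i$-th coordinate projection. For a $\ast$-operator frame (or $\ast$-operator Bessel sequence) $\{T_{i}\}_{i\in I}$, its $\ast$-operator frame transform is the adjointable map $\mathcal{H}\to l^{2}(\mathcal{H})$, $x\mapsto(T_{i}x)_{i\in I}$. Its $\ast$-frame operator is the operator $x\mapsto\sum_{i\in I}T_{i}^{*}T_{i}x$ on $\mathcal{H}$, i.e. the adjoint of the transform composed with the transform. The $\ast$-frame operator of a $\ast$-operator frame is invertible. The canonical dual $\ast$-operator frame of $\{\Lambda_{i}\}_{i\in I}$ with $\ast$-frame operator $S$ is $\{\tilde{\Lambda}_{i}\}_{i\in I}=\{\Lambda_{i}S^{-1}\}_{i\in I}$. $I$ also denotes the identity operator on $\mathcal{H}$ or $l^{2}(\mathcal{H})$. *)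

theory Defs
  imports "HOL-Analysis.Analysis" "HOL-Library.Function_Algebras"
begin

section \<open>Unital C*-algebras\<close>

class scaleC =
  fixes scaleC :: "complex \<Rightarrow> 'a \<Rightarrow> 'a" (infixr "*\<^sub>C" 75)

class complex_normed_space = scaleC + real_normed_vector +
  assumes scaleC_add_right: "c *\<^sub>C (x + y) = c *\<^sub>C x + c *\<^sub>C y"
    and scaleC_add_left: "(c + d) *\<^sub>C x = c *\<^sub>C x + d *\<^sub>C x"
    and scaleC_scaleC: "c *\<^sub>C (d *\<^sub>C x) = (c * d) *\<^sub>C x"
    and scaleR_scaleC: "r *\<^sub>R x = complex_of_real r *\<^sub>C x"
    and norm_scaleC: "norm (c *\<^sub>C x) = cmod c * norm x"

class complex_banach = complex_normed_space + banach

text \<open>The unit comes from \<^class>\<open>monoid_mult\<close> rather than from \<^class>\<open>real_normed_algebra_1\<close>,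
  so that the zero algebra is not excluded.\<close>

class unital_cstar_algebra = complex_banach + real_normed_algebra + monoid_mult +
  fixes star :: "'a \<Rightarrow> 'a"
  assumes scaleC_mult_left: "(c *\<^sub>C a) * b = c *\<^sub>C (a * b)"
    and scaleC_mult_right: "a * (c *\<^sub>C b) = c *\<^sub>C (a * b)"
    and star_star: "star (star a) = a"
    and star_add: "star (a + b) = star a + star b"
    and star_scaleC: "star (c *\<^sub>C a) = cnj c *\<^sub>C star a"
    and star_mult: "star (a * b) = star b * star a"
    and cstar_identity: "norm (star a * a) = (norm a)\<^sup>2"

definition alg_invertible :: "'a::unital_cstar_algebra \<Rightarrow> bool" where
  "alg_invertible a \<longleftrightarrow> (\<exists>b. a * b = 1 \<and> b * a = 1)"

definition spectrum :: "'a::unital_cstar_algebra \<Rightarrow> complex set" where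
  "spectrum a = {c. \<not> alg_invertible (c *\<^sub>C 1 - a)}"

definition strictly_nonzero :: "'a::unital_cstar_algebra \<Rightarrow> bool" where
  "strictly_nonzero a \<longleftrightarrow> 0 \<notin> spectrum a"

definition cstar_positive :: "'a::unital_cstar_algebra \<Rightarrow> bool" where
  "cstar_positive a \<longleftrightarrow> star a = a \<and> spectrum a \<subseteq> complex_of_real ` {0..}"

definition cstar_le :: "'a::unital_cstar_algebra \<Rightarrow> 'a \<Rightarrow> bool" (infix "\<preceq>" 50) where
  "a \<preceq> b \<longleftrightarrow> cstar_positive (b - a)"


section \<open>Hilbert modules\<close>

text \<open>A left Hilbert module over \<^typ>\<open>'a\<close> whose underlying set is the whole type \<^typ>\<open>'h\<close>.
  The norm of \<^typ>\<open>'h\<close> is required to be the one induced by the inner product, and completeness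
  for it is part of the class \<^class>\<open>complex_banach\<close>.\<close>

locale hilbert_cstar_module =
  fixes act :: "'a::unital_cstar_algebra \<Rightarrow> 'h::complex_banach \<Rightarrow> 'h" (infixr "\<odot>" 75)
    and ip :: "'h \<Rightarrow> 'h \<Rightarrow> 'a"
  assumes act_add_left: "(a + b) \<odot> x = a \<odot> x + b \<odot> x"
    and act_add_right: "a \<odot> (x + y) = a \<odot> x + a \<odot> y"
    and act_mult: "(a * b) \<odot> x = a \<odot> (b \<odot> x)"
    and act_one: "1 \<odot> x = x"
    and act_scaleC_left: "(c *\<^sub>C a) \<odot> x = c *\<^sub>C (a \<odot> x)"
    and act_scaleC_right: "a \<odot> (c *\<^sub>C x) = c *\<^sub>C (a \<odot> x)"
    and ip_add_left: "ip (x + y) z = ip x z + ip y z"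
    and ip_act_left: "ip (a \<odot> x) y = a * ip x y"
    and ip_star: "star (ip x y) = ip y x"
    and ip_positive: "cstar_positive (ip x x)"
    and ip_definite: "ip x x = 0 \<Longrightarrow> x = 0"
    and norm_ip: "norm x = sqrt (norm (ip x x))"

text \<open>Families indexed by \<open>I\<close> are represented by functions on the index type that vanish off \<open>I\<close>;
  the module operations of \<open>l\<^sup>2(H)\<close> are the pointwise ones from
  \<^theory>\<open>HOL-Library.Function_Algebras\<close>.\<close>

definition l2 :: "'i set \<Rightarrow> ('h \<Rightarrow> 'h \<Rightarrow> 'a::unital_cstar_algebra) \<Rightarrow> ('i \<Rightarrow> 'h::complex_banach) set" where
  "l2 I ip = {f. (\<forall>i. i \<notin> I \<longrightarrow> f i = 0) \<and> (\<lambda>i. ip (f i) (f i)) summable_on I}"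

definition l2_ip :: "'i set \<Rightarrow> ('h \<Rightarrow> 'h \<Rightarrow> 'a::unital_cstar_algebra)
    \<Rightarrow> ('i \<Rightarrow> 'h::complex_banach) \<Rightarrow> ('i \<Rightarrow> 'h) \<Rightarrow> 'a" where
  "l2_ip I ip f g = (\<Sum>\<^sub>\<infinity>i\<in>I. ip (f i) (g i))"

definition coord :: "'i \<Rightarrow> ('i \<Rightarrow> 'h) \<Rightarrow> 'h" where
  "coord i f = f i"


section \<open>Adjointable maps\<close>

text \<open>\<open>is_adjointable ip W ipW T\<close>: the map \<open>T\<close> from the module \<open>H\<close> with inner product \<open>ip\<close> to the
  module with carrier \<open>W\<close> and inner product \<open>ipW\<close> is adjointable. Module linearity and
  boundedness are consequences. Only maps defined on \<open>H\<close> are needed, with \<open>W\<close> either \<open>H\<close> or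
  \<open>l\<^sup>2(H)\<close>.\<close>

definition is_adjointable :: "('h \<Rightarrow> 'h \<Rightarrow> 'a) \<Rightarrow> 'k set \<Rightarrow> ('k \<Rightarrow> 'k \<Rightarrow> 'a) \<Rightarrow> ('h \<Rightarrow> 'k) \<Rightarrow> bool" where
  "is_adjointable ip W ipW T \<longleftrightarrow>
     (\<forall>x. T x \<in> W) \<and> (\<exists>T'. \<forall>x. \<forall>y\<in>W. ipW (T x) y = ip x (T' y))"

text \<open>The adjoint is meaningful on \<open>W\<close> only.\<close>

definition adj :: "('h \<Rightarrow> 'h \<Rightarrow> 'a) \<Rightarrow> ('k \<Rightarrow> 'k \<Rightarrow> 'a) \<Rightarrow> ('h \<Rightarrow> 'k) \<Rightarrow> 'k \<Rightarrow> 'h" where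
  "adj ip ipW T y = (THE x. \<forall>z. ipW (T z) y = ip z x)"

abbreviation adjointable :: "('h \<Rightarrow> 'h \<Rightarrow> 'a) \<Rightarrow> ('h \<Rightarrow> 'h) \<Rightarrow> bool" where
  "adjointable ip \<equiv> is_adjointable ip UNIV ip"

abbreviation adjointable_l2 :: "'i set \<Rightarrow> ('h \<Rightarrow> 'h \<Rightarrow> 'a::unital_cstar_algebra)
    \<Rightarrow> ('h::complex_banach \<Rightarrow> 'i \<Rightarrow> 'h) \<Rightarrow> bool" where
  "adjointable_l2 I ip \<equiv> is_adjointable ip (l2 I ip) (l2_ip I ip)"

abbreviation adj_H :: "('h \<Rightarrow> 'h \<Rightarrow> 'a) \<Rightarrow> ('h \<Rightarrow> 'h) \<Rightarrow> 'h \<Rightarrow> 'h" where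
  "adj_H ip \<equiv> adj ip ip"

abbreviation adj_l2 :: "'i set \<Rightarrow> ('h \<Rightarrow> 'h \<Rightarrow> 'a::unital_cstar_algebra)
    \<Rightarrow> ('h::complex_banach \<Rightarrow> 'i \<Rightarrow> 'h) \<Rightarrow> ('i \<Rightarrow> 'h) \<Rightarrow> 'h" where
  "adj_l2 I ip \<equiv> adj ip (l2_ip I ip)"


section \<open>\<open>*\<close>-operator frames\<close>

text \<open>All series over \<open>I\<close> are unordered sums. For norm-convergent series of positive elements, and
  for the series \<open>\<Sum> T\<^sub>i\<^sup>* x\<^sub>i\<close> attached to Bessel sequences, this agrees with convergence along
  any enumeration of \<open>I\<close>.\<close>

definition star_operator_frame :: "'i set \<Rightarrow> ('h \<Rightarrow> 'h \<Rightarrow> 'a::unital_cstar_algebra)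
    \<Rightarrow> ('i \<Rightarrow> 'h \<Rightarrow> 'h) \<Rightarrow> bool" where
  "star_operator_frame I ip T \<longleftrightarrow>
     (\<forall>i\<in>I. adjointable ip (T i)) \<and>
     (\<forall>x. (\<lambda>i. ip (T i x) (T i x)) summable_on I) \<and>
     (\<exists>A B. strictly_nonzero A \<and> strictly_nonzero B \<and>
        (\<forall>x. A * ip x x * star A \<preceq> (\<Sum>\<^sub>\<infinity>i\<in>I. ip (T i x) (T i x)) \<and>
             (\<Sum>\<^sub>\<infinity>i\<in>I. ip (T i x) (T i x)) \<preceq> B * ip x x * star B))"

definition star_operator_bessel :: "'i set \<Rightarrow> ('h \<Rightarrow> 'h \<Rightarrow> 'a::unital_cstar_algebra)
    \<Rightarrow> ('i \<Rightarrow> 'h \<Rightarrow> 'h) \<Rightarrow> bool" where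
  "star_operator_bessel I ip T \<longleftrightarrow>
     (\<forall>i\<in>I. adjointable ip (T i)) \<and>
     (\<forall>x. (\<lambda>i. ip (T i x) (T i x)) summable_on I) \<and>
     (\<exists>B. strictly_nonzero B \<and>
        (\<forall>x. (\<Sum>\<^sub>\<infinity>i\<in>I. ip (T i x) (T i x)) \<preceq> B * ip x x * star B))"

definition frame_transform :: "'i set \<Rightarrow> ('i \<Rightarrow> 'h \<Rightarrow> 'h::zero) \<Rightarrow> 'h \<Rightarrow> 'i \<Rightarrow> 'h" where
  "frame_transform I T x = (\<lambda>i. if i \<in> I then T i x else 0)"

definition frame_operator :: "'i set \<Rightarrow> ('h \<Rightarrow> 'h \<Rightarrow> 'a) \<Rightarrow> ('i \<Rightarrow> 'h \<Rightarrow> 'h::complex_banach)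
    \<Rightarrow> 'h \<Rightarrow> 'h" where
  "frame_operator I ip T x = (\<Sum>\<^sub>\<infinity>i\<in>I. adj_H ip (T i) (T i x))"

definition canonical_dual :: "'i set \<Rightarrow> ('h \<Rightarrow> 'h \<Rightarrow> 'a) \<Rightarrow> ('i \<Rightarrow> 'h \<Rightarrow> 'h::complex_banach)
    \<Rightarrow> 'i \<Rightarrow> 'h \<Rightarrow> 'h" where
  "canonical_dual I ip T i = T i \<circ> inv (frame_operator I ip T)"

definition dual_star_operator_frame :: "'i set \<Rightarrow> ('h \<Rightarrow> 'h \<Rightarrow> 'a::unital_cstar_algebra)
    \<Rightarrow> ('i \<Rightarrow> 'h \<Rightarrow> 'h::complex_banach) \<Rightarrow> ('i \<Rightarrow> 'h \<Rightarrow> 'h) \<Rightarrow> bool" where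
  "dual_star_operator_frame I ip \<Lambda> \<Omega> \<longleftrightarrow>
     star_operator_frame I ip \<Lambda> \<and> star_operator_frame I ip \<Omega> \<and>
     (\<forall>x. ((\<lambda>i. adj_H ip (\<Lambda> i) (\<Omega> i x)) has_sum x) I)"

end

theory Submission
  imports Defs
begin

text \<open>The order of the algebra is handled through the norm: a self-adjoint \<open>a\<close> is positive iff
  \<open>\<parallel>t - a\<parallel> \<le> t\<close> for some \<open>t \<ge> 0\<close>, and this condition is visibly stable under sums. The only functional
  calculus needed for the equivalence is the square root of \<open>1 - y\<close> for \<open>\<parallel>y\<parallel> < 1\<close>, obtained as a
  Banach fixed point. Adjointable maps are bounded by the uniform boundedness principle.
  For a Bessel sequence the Cauchy--Schwarz inequality makes \<open>\<Sum> T\<^sub>i\<^sup>* f\<^sub>i\<close> converge on \<open>l\<^sup>2(H)\<close>, and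
  the sum is the adjoint of the transform. The frame operator \<open>S = \<theta>\<^sup>*\<theta>\<close> is positive and bounded
  below, hence bijective, and the six statements become algebra with \<open>\<theta>\<^sup>*\<eta> = I\<close>. The exceptions are
  the frame bounds of \<open>\<Pi>\<^sub>i\<eta>'\<close>: the upper one is \<open>\<langle>P x, x\<rangle> \<le> M \<langle>x, x\<rangle>\<close> for symmetric \<open>P\<close>, the lower one
  follows from it and \<open>\<theta>\<^sup>*\<eta>' = I\<close>. In (6) one may take \<open>\<Delta> = \<Omega>\<close>.\<close>

section \<open>Positivity in unital C*-algebras\<close>

lemma scaleC_one [simp]: "1 *\<^sub>C (x::'a::complex_normed_space) = x"
  using scaleR_scaleC[of 1 x] by simp

lemma scaleC_of_real: "complex_of_real r *\<^sub>C (x::'a::complex_normed_space) = r *\<^sub>R x"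
  by (simp add: scaleR_scaleC)

lemma scaleC_zero_left [simp]: "0 *\<^sub>C (x::'a::complex_normed_space) = 0"
  using scaleC_of_real[of 0 x] by simp

lemma scaleC_zero_right [simp]: "c *\<^sub>C (0::'a::complex_normed_space) = 0"
  using scaleC_add_right[of c 0 "0::'a"] by simp

lemma scaleC_minus_left: "(- c) *\<^sub>C (x::'a::complex_normed_space) = - (c *\<^sub>C x)"
  using scaleC_add_left[of c "-c" x] by (simp add: eq_neg_iff_add_eq_0 add.commute)

lemma scaleC_minus_right: "c *\<^sub>C (- x::'a::complex_normed_space) = - (c *\<^sub>C x)"
  using scaleC_add_right[of c x "-x"] by (simp add: eq_neg_iff_add_eq_0 add.commute)

lemma scaleC_diff_right: "c *\<^sub>C (x - y::'a::complex_normed_space) = c *\<^sub>C x - c *\<^sub>C y"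
  using scaleC_add_right[of c x "-y"] by (simp add: scaleC_minus_right)

lemma star_zero [simp]: "star (0::'a::unital_cstar_algebra) = 0"
  using star_add[of 0 "0::'a"] by simp

lemma star_minus: "star (- a::'a::unital_cstar_algebra) = - star a"
  using star_add[of a "-a"] by (simp add: eq_neg_iff_add_eq_0 add.commute)

lemma star_diff: "star (a - b::'a::unital_cstar_algebra) = star a - star b"
  using star_add[of a "-b"] by (simp add: star_minus)

lemma star_scaleR: "star (r *\<^sub>R a::'a::unital_cstar_algebra) = r *\<^sub>R star a"
  by (simp add: scaleR_scaleC star_scaleC)

lemma star_one [simp]: "star (1::'a::unital_cstar_algebra) = 1"
  by (metis mult_1_left mult_1_right star_mult star_star)

lemma star_sum: "star (sum f F) = (\<Sum>i\<in>F. star (f i :: 'a::unital_cstar_algebra))"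
  by (induction F rule: infinite_finite_induct) (auto simp: star_add)

lemma norm_star [simp]: "norm (star a) = norm (a::'a::unital_cstar_algebra)"
proof -
  have *: "norm a \<le> norm (star a)" for a :: 'a
  proof (cases "norm a = 0")
    case False
    have "norm a * norm a \<le> norm (star a) * norm a"
      using norm_mult_ineq[of "star a" a] by (simp add: cstar_identity power2_eq_square)
    then show ?thesis
      using False by simp
  qed auto
  show ?thesis
    using *[of a] *[of "star a"] by (simp add: star_star)
qed

lemma norm_selfadjoint_square:
  "star a = a \<Longrightarrow> norm (a * a) = (norm a)\<^sup>2" for a :: "'a::unital_cstar_algebra"
  using cstar_identity[of a] by simp

text \<open>By the C*-identity \<open>norm 1\<close> equals its own square. Only an inequality is
  stated because the class admits the zero algebra.\<close>

lemma norm_one_le: "norm (1::'a::unital_cstar_algebra) \<le> 1"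
proof -
  have "norm (1::'a) * norm (1::'a) = norm (1::'a)"
    using cstar_identity[of "1::'a"] by (simp add: power2_eq_square)
  then show ?thesis
    by (metis less_eq_real_def mult_cancel_right1 norm_zero zero_le_one norm_ge_zero)
qed

lemma norm_scaleR_one_le: "norm (t *\<^sub>R (1::'a::unital_cstar_algebra)) \<le> \<bar>t\<bar>"
  using norm_one_le[where 'a='a] mult_left_le by fastforce

lemma bounded_linear_star: "bounded_linear (star :: 'a::unital_cstar_algebra \<Rightarrow> 'a)"
  by (rule bounded_linear_intro[where K=1]) (auto simp: star_add star_scaleR)

text \<open>Fixed points of \<open>1 + w * x\<close> and \<open>1 + y * w\<close> replace the
  Neumann series: they are a right and a left inverse of \<open>1 - w\<close>, hence equal by
  associativity.\<close>

lemma Neumann_invertible: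
  fixes z :: "'a::unital_cstar_algebra"
  assumes "norm z < cmod \<mu>"
  shows "alg_invertible (\<mu> *\<^sub>C 1 - z)"
proof -
  have mu: "\<mu> \<noteq> 0"
    using assms by auto
  define w where "w = inverse \<mu> *\<^sub>C z"
  have "norm w = norm z / cmod \<mu>"
    by (simp add: w_def norm_scaleC norm_inverse divide_inverse mult.commute)
  then have w: "norm w < 1"
    using assms mu by simp
  have "\<exists>!x. 1 + w * x = x"
  proof (rule banach_fix_type[of "norm w"])
    show "\<forall>x y. dist (1 + w * x) (1 + w * y) \<le> norm w * dist x y"
      by (auto simp: dist_norm norm_mult_ineq simp flip: right_diff_distrib)
  qed (use w in auto)
  then obtain x where x: "1 + w * x = x" by auto
  have "\<exists>!y. 1 + y * w = y"
  proof (rule banach_fix_type[of "norm w"])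
    show "\<forall>x y. dist (1 + x * w) (1 + y * w) \<le> norm w * dist x y"
      by (auto simp: dist_norm mult.commute[of "norm w"] norm_mult_ineq simp flip: left_diff_distrib)
  qed (use w in auto)
  then obtain y where y: "1 + y * w = y" by auto
  have 1: "(1 - w) * x = 1" "y * (1 - w) = 1"
    using x y by (auto simp: algebra_simps)
  then have yx: "y = x"
    by (metis mult.assoc mult_1_left mult_1_right)
  have eq: "\<mu> *\<^sub>C 1 - z = \<mu> *\<^sub>C (1 - w)"
    using mu by (simp add: scaleC_diff_right w_def scaleC_scaleC)
  have "(\<mu> *\<^sub>C 1 - z) * (inverse \<mu> *\<^sub>C x) = 1" "(inverse \<mu> *\<^sub>C x) * (\<mu> *\<^sub>C 1 - z) = 1"
    unfolding eq using 1 yx mu by (simp_all add: scaleC_mult_left scaleC_mult_right scaleC_scaleC)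
  then show ?thesis
    unfolding alg_invertible_def by blast
qed

text \<open>Substituting \<open>w = 1 - z\<close> turns \<open>w * w = 1 - y\<close> into
  \<open>z = (y + z * z) / 2\<close>, which a contraction solves. The commutation clause later lets
  square roots of related elements commute with each other.\<close>

lemma selfadjoint_sqrt_ex:
  fixes y :: "'a::unital_cstar_algebra"
  assumes "star y = y" "norm y < 1"
  shows "\<exists>w. star w = w \<and> w * w = 1 - y \<and> (\<forall>c. c * y = y * c \<longrightarrow> c * w = w * c)"
proof -
  \<comment> \<open>The smaller root of \<open>norm y + \<rho> * \<rho> = 2 * \<rho>\<close>: the
    ball of this radius is mapped into itself, and \<open>\<rho> < 1\<close> is the contraction
    constant.\<close>
  define \<rho> where "\<rho> = 1 - sqrt (1 - norm y)"
  have rho: "0 \<le> \<rho>" "\<rho> < 1" "norm y + \<rho> * \<rho> = 2 * \<rho>"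
    using assms(2) by (auto simp: \<rho>_def algebra_simps real_sqrt_mult_self)
  \<comment> \<open>Self-adjointness and commutation with the commutant of \<open>y\<close> are
    closed conditions preserved by \<open>f\<close>; building them into \<open>X\<close> passes them
    on to the fixed point.\<close>
  define X where "X = cball 0 \<rho> \<inter> {z. star z = z} \<inter> (\<Inter>c\<in>{c. c * y = y * c}. {z. c * z = z * c})"
  define f where "f z = (1/2) *\<^sub>R (y + z * z)" for z
  have "\<exists>!z\<in>X. f z = z"
  proof (rule Banach_fix[of X \<rho>])
    have "closed {z::'a. star z = z}"
      by (intro closed_Collect_eq linear_continuous_on bounded_linear_star continuous_intros)
    moreover have "closed {z. c * z = z * c}" for c :: 'a
      by (intro closed_Collect_eq continuous_intros)
    ultimately show "complete X"
      unfolding X_def complete_eq_closed by (intro closed_Int closed_INT ballI closed_cball)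
    have "0 \<in> X"
      using rho(1) by (simp add: X_def)
    then show "X \<noteq> {}"
      by blast
    show "f ` X \<subseteq> X"
    proof (rule image_subsetI)
      fix z assume "z \<in> X"
      then have z: "norm z \<le> \<rho>" "star z = z" and zc: "\<And>c. c * y = y * c \<Longrightarrow> c * z = z * c"
        unfolding X_def by simp_all
      have "norm (z * z) \<le> \<rho> * \<rho>"
        using z rho by (intro order.trans[OF norm_mult_ineq] mult_mono) auto
      then have "norm (y + z * z) \<le> 2 * \<rho>"
        using norm_triangle_ineq[of y "z * z"] rho by simp
      then have "norm (f z) \<le> \<rho>"
        by (simp add: f_def)
      moreover have "star (f z) = f z"
        using z assms(1) by (simp add: f_def star_scaleR star_add star_mult)
      moreover have "c * f z = f z * c" if c: "c * y = y * c" for c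
      proof -
        have "c * z = z * c"
          using c by (rule zc)
        then have "c * (z * z) = z * z * c"
          by (metis mult.assoc)
        then show ?thesis
          by (simp add: f_def distrib_left distrib_right c)
      qed
      ultimately show "f z \<in> X"
        unfolding X_def by simp
    qed
    show "dist (f x) (f z) \<le> \<rho> * dist x z" if "x \<in> X" "z \<in> X" for x z
    proof -
      have "x * x - z * z = (x - z) * x + z * (x - z)"
        by (simp add: algebra_simps)
      then have "norm (x * x - z * z) \<le> norm (x - z) * norm x + norm z * norm (x - z)"
        by (metis norm_triangle_mono norm_mult_ineq)
      also have "\<dots> \<le> norm (x - z) * \<rho> + \<rho> * norm (x - z)"
        using that rho(1) unfolding X_def by (intro add_mono mult_mono) simp_all
      finally show ?thesis
        by (simp add: f_def dist_norm flip: scaleR_diff_right)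
    qed
  qed (use rho in auto)
  then obtain z where "z \<in> X" and fz: "f z = z" by auto
  then have z: "star z = z" and zc: "\<And>c. c * y = y * c \<Longrightarrow> c * z = z * c"
    unfolding X_def by simp_all
  have "2 *\<^sub>R f z = y + z * z" by (simp add: f_def)
  then have "z + z = y + z * z" using fz by (simp add: scaleR_2)
  then have "y = z + z - z * z" by simp
  then have "(1 - z) * (1 - z) = 1 - y"
    by (simp add: right_diff_distrib left_diff_distrib)
  moreover have "star (1 - z) = 1 - z" "\<forall>c. c * y = y * c \<longrightarrow> c * (1 - z) = (1 - z) * c"
    using zc by (simp_all add: star_diff z right_diff_distrib left_diff_distrib)
  ultimately show ?thesis by blast
qed

text \<open>Let \<open>r\<close> and \<open>w\<close> be the real and imaginary parts of
  \<open>v\<close>. As they commute, \<open>star v * v\<close> is the scalar \<open>t\<close>, so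
  the C*-identity bounds \<open>norm v\<close>, and \<open>r\<close> is the mean of \<open>v\<close>
  and \<open>star v\<close>.\<close>

lemma norm_sum_of_squares_le:
  fixes r w :: "'a::unital_cstar_algebra"
  assumes "star r = r" "star w = w" "r * w = w * r" "r * r + w * w = t *\<^sub>R 1"
  shows "norm (r * r) \<le> \<bar>t\<bar>"
proof -
  define v where "v = r + \<i> *\<^sub>C w"
  have sv: "star v = r - \<i> *\<^sub>C w"
    using assms by (simp add: v_def star_add star_scaleC scaleC_minus_left)
  have "star v * v = r * r + w * w"
    using assms(3)
    by (simp add: sv) (simp add: v_def algebra_simps scaleC_mult_left scaleC_mult_right scaleC_scaleC
        scaleC_minus_left scaleC_add_right scaleC_diff_right)
  then have "(norm v)\<^sup>2 \<le> \<bar>t\<bar>"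
    using cstar_identity[of v] norm_scaleR_one_le[of t, where 'a='a] assms(4) by simp
  moreover have "2 *\<^sub>R r = v + star v"
    unfolding sv by (simp add: v_def scaleR_2)
  then have "2 * norm r \<le> norm v + norm v"
    using norm_triangle_ineq[of v "star v"] by (metis norm_scaleR norm_star abs_numeral)
  ultimately show ?thesis
    using norm_selfadjoint_square[OF assms(1)]
    by (smt (verit, best) norm_ge_zero power_mono)
qed

section \<open>The cone given by the norm condition and its order properties\<close>

definition norm_positive :: "'a::unital_cstar_algebra \<Rightarrow> bool" where
  "norm_positive a \<longleftrightarrow> star a = a \<and> (\<exists>t\<ge>0. norm (t *\<^sub>R 1 - a) \<le> t)"

lemma norm_positive_add:
  assumes "norm_positive a" "norm_positive b"
  shows "norm_positive (a + b)"
proof -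
  obtain s t where st: "s \<ge> 0" "t \<ge> 0" "norm (s *\<^sub>R 1 - a) \<le> s" "norm (t *\<^sub>R 1 - b) \<le> t"
    using assms by (auto simp: norm_positive_def)
  have "(s + t) *\<^sub>R 1 - (a + b) = (s *\<^sub>R 1 - a) + (t *\<^sub>R 1 - b)"
    by (simp add: algebra_simps)
  then have "norm ((s + t) *\<^sub>R 1 - (a + b)) \<le> s + t"
    using st by (metis norm_triangle_mono)
  then show ?thesis
    using assms st by (auto simp: norm_positive_def star_add intro!: exI[of _ "s + t"])
qed

lemma norm_positive_zero [simp]: "norm_positive 0"
  by (auto simp: norm_positive_def)

lemma norm_positive_sum: "(\<And>i. i \<in> F \<Longrightarrow> norm_positive (f i)) \<Longrightarrow> norm_positive (sum f F)"
  by (induction F rule: infinite_finite_induct) (auto simp: norm_positive_add)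

lemma norm_positive_scaleR:
  assumes "norm_positive a" "c \<ge> 0"
  shows "norm_positive (c *\<^sub>R a)"
proof -
  obtain s where s: "s \<ge> 0" "norm (s *\<^sub>R 1 - a) \<le> s"
    using assms by (auto simp: norm_positive_def)
  have "norm ((c * s) *\<^sub>R 1 - c *\<^sub>R a) = c * norm (s *\<^sub>R 1 - a)"
    using assms(2) by (metis abs_of_nonneg norm_scaleR scaleR_right_diff_distrib scaleR_scaleR)
  then show ?thesis
    using assms s by (auto simp: norm_positive_def star_scaleR mult_left_mono intro!: exI[of _ "c * s"])
qed

text \<open>Write \<open>a + \<epsilon>\<close> as \<open>(t + \<epsilon>) (1 - y)\<close>. The
  shift by \<open>\<epsilon>\<close> makes \<open>norm y \<le> t / (t + \<epsilon>)\<close> strictly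
  less than 1, as the square root of \<open>1 - y\<close> requires.\<close>

lemma norm_positive_sqrt_ex:
  assumes "norm_positive a" "\<epsilon> > 0"
  shows "\<exists>r. star r = r \<and> r * r = a + \<epsilon> *\<^sub>R 1 \<and> (\<forall>c. c * a = a * c \<longrightarrow> c * r = r * c)"
proof -
  obtain t where t: "t \<ge> 0" "norm (t *\<^sub>R 1 - a) \<le> t" and sa: "star a = a"
    using assms by (auto simp: norm_positive_def)
  define y where "y = (1 / (t + \<epsilon>)) *\<^sub>R (t *\<^sub>R 1 - a)"
  have "norm y < 1"
    using t assms(2) by (simp add: y_def)
  moreover have "star y = y"
    by (simp add: y_def star_scaleR star_diff sa)
  ultimately obtain w where w: "star w = w" "w * w = 1 - y" "\<forall>c. c * y = y * c \<longrightarrow> c * w = w * c"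
    using selfadjoint_sqrt_ex by blast
  define r where "r = sqrt (t + \<epsilon>) *\<^sub>R w"
  have "(t + \<epsilon>) *\<^sub>R y = t *\<^sub>R 1 - a"
    using t assms(2) by (simp add: y_def)
  then have "r * r = a + \<epsilon> *\<^sub>R 1"
    using t assms(2) by (simp add: r_def w(2) scaleR_diff_right) (simp add: algebra_simps)
  moreover have "c * y = y * c" if "c * a = a * c" for c
    using that by (simp add: y_def algebra_simps)
  then have "\<forall>c. c * a = a * c \<longrightarrow> c * r = r * c"
    using w(3) by (simp add: r_def)
  moreover have "star r = r"
    by (simp add: r_def star_scaleR w(1))
  ultimately show ?thesis
    by blast
qed

text \<open>Every \<open>t\<close> above \<open>norm a\<close> is an admissible witness. Commuting
  square roots \<open>r\<close> of \<open>a + \<epsilon>\<close> and \<open>u\<close> of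
  \<open>T - (a + \<epsilon>)\<close> have squares adding up to \<open>T\<close>, so
  \<open>norm (u * u) \<le> T\<close>, and \<open>t - a\<close> is within \<open>\<epsilon>\<close>
  of \<open>u * u\<close>.\<close>

lemma norm_positive_norm_le:
  assumes "norm_positive a" "norm a \<le> t"
  shows "norm (t *\<^sub>R 1 - a) \<le> t"
proof (rule field_le_epsilon)
  fix e :: real assume e: "e > 0"
  define \<epsilon> where "\<epsilon> = e / 3"
  have eps: "\<epsilon> > 0" using e by (simp add: \<epsilon>_def)
  have t: "t \<ge> 0" using assms(2) norm_ge_zero[of a] by linarith
  have sa: "star a = a" using assms(1) by (simp add: norm_positive_def)
  obtain r where r: "star r = r" "r * r = a + \<epsilon> *\<^sub>R 1" "\<forall>c. c * a = a * c \<longrightarrow> c * r = r * c"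
    using norm_positive_sqrt_ex[OF assms(1) eps] by blast
  have "r * (a + \<epsilon> *\<^sub>R 1) = (a + \<epsilon> *\<^sub>R 1) * r"
    by (metis r(2) mult.assoc)
  then have ra: "r * a = a * r"
    by (simp add: algebra_simps)
  \<comment> \<open>One \<open>\<epsilon>\<close> more than the bound \<open>t + \<epsilon>\<close>
    on \<open>norm (a + \<epsilon>)\<close>, so that \<open>norm y < 1\<close> is strict.\<close>
  define T where "T = t + 2 * \<epsilon>"
  have T: "T > 0" using t eps by (simp add: T_def)
  define y where "y = (1 / T) *\<^sub>R (a + \<epsilon> *\<^sub>R 1)"
  have "norm (a + \<epsilon> *\<^sub>R 1) \<le> t + \<epsilon>"
    using eps assms(2) norm_scaleR_one_le[of \<epsilon>, where 'a='a] norm_triangle_ineq[of a "\<epsilon> *\<^sub>R 1"] by linarith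
  then have "norm y < 1"
    using T eps by (simp add: y_def T_def)
  moreover have "star y = y"
    by (simp add: y_def star_scaleR star_add sa)
  ultimately obtain w where w: "star w = w" "w * w = 1 - y" "\<forall>c. c * y = y * c \<longrightarrow> c * w = w * c"
    using selfadjoint_sqrt_ex by blast
  define u where "u = sqrt T *\<^sub>R w"
  have Ty: "T *\<^sub>R y = a + \<epsilon> *\<^sub>R 1"
    using T by (simp add: y_def)
  have uu: "u * u = T *\<^sub>R 1 - (a + \<epsilon> *\<^sub>R 1)"
    using T by (simp add: u_def w(2) scaleR_diff_right Ty)
  have "r * w = w * r"
    using w(3) ra by (simp add: y_def algebra_simps)
  then have "u * r = r * u" "star u = u"
    by (simp_all add: u_def w(1) star_scaleR)
  then have "norm (u * u) \<le> \<bar>T\<bar>"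
    by (intro norm_sum_of_squares_le[of u r]) (simp_all add: r uu)
  moreover have "t *\<^sub>R 1 - a = u * u + (- \<epsilon>) *\<^sub>R 1"
    unfolding uu T_def by (simp add: algebra_simps scaleR_2[symmetric])
  ultimately have "norm (t *\<^sub>R 1 - a) \<le> \<bar>T\<bar> + \<bar>-\<epsilon>\<bar>"
    by (metis norm_triangle_mono norm_scaleR_one_le)
  then show "norm (t *\<^sub>R 1 - a) \<le> t + e"
    using T eps by (simp add: T_def \<epsilon>_def)
qed

text \<open>Fixing the witness \<open>t = norm a\<close> removes the quantifier and leaves
  conditions continuous in \<open>a\<close>, from which closedness of the cone follows.\<close>

lemma norm_positive_iff:
  "norm_positive a \<longleftrightarrow> star a = a \<and> norm (norm a *\<^sub>R 1 - a) \<le> norm a"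
  using norm_positive_norm_le[of a "norm a"] unfolding norm_positive_def
  by (metis norm_ge_zero order.refl)

lemma closed_norm_positive: "closed {a :: 'a::unital_cstar_algebra. norm_positive a}"
  unfolding norm_positive_iff Collect_conj_eq
  by (intro closed_Int closed_Collect_eq closed_Collect_le linear_continuous_on bounded_linear_star
      continuous_intros)

lemma norm_positive_diff_scaleR_one:
  assumes "star a = a" "norm a \<le> t"
  shows "norm_positive (t *\<^sub>R 1 - a)"
  using assms norm_ge_zero[of a]
  by (auto simp: norm_positive_def star_diff star_scaleR simp del: norm_ge_zero intro!: exI[of _ t])

text \<open>For large \<open>T\<close> the complement \<open>T - r * r\<close> is a square
  \<open>u * u\<close> with \<open>u\<close> commuting with \<open>r\<close>. The bound for sums of
  squares gives \<open>norm (T - r * r) \<le> T\<close>, so \<open>T\<close> is the witness.\<close>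

lemma norm_positive_square:
  fixes r :: "'a::unital_cstar_algebra"
  assumes "star r = r"
  shows "norm_positive (r * r)"
proof -
  define T where "T = (norm r)\<^sup>2 + 1"
  have T: "T > 0" by (simp add: T_def add_nonneg_pos)
  define y where "y = (1 / T) *\<^sub>R (r * r)"
  have "norm y < 1"
    using T by (simp add: y_def norm_selfadjoint_square[OF assms]) (simp add: T_def)
  moreover have "star y = y"
    by (simp add: y_def star_scaleR star_mult assms)
  ultimately obtain w where w: "star w = w" "w * w = 1 - y" "\<forall>c. c * y = y * c \<longrightarrow> c * w = w * c"
    using selfadjoint_sqrt_ex by blast
  define u where "u = sqrt T *\<^sub>R w"
  have uu: "u * u = T *\<^sub>R 1 - r * r"
    using T by (simp add: u_def w(2) scaleR_diff_right y_def)
  have "r * w = w * r"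
    using w(3) by (simp add: y_def mult.assoc)
  then have "u * r = r * u" "star u = u"
    by (simp_all add: u_def w(1) star_scaleR)
  then have "norm (u * u) \<le> \<bar>T\<bar>"
    by (intro norm_sum_of_squares_le[of u r]) (simp_all add: assms uu)
  then show ?thesis
    using T by (auto simp: norm_positive_def star_mult assms uu intro!: exI[of _ T])
qed

text \<open>Both \<open>a\<close> and \<open>norm b - a\<close> are positive, the latter as the sum
  of \<open>norm b - b\<close> and \<open>b - a\<close>. Their approximate square roots commute, and
  the squares add up to the scalar \<open>norm b + 2 \<epsilon>\<close>.\<close>

lemma norm_mono_positive:
  fixes a b :: "'a::unital_cstar_algebra"
  assumes "norm_positive a" "norm_positive (b - a)"
  shows "norm a \<le> norm b"
proof (rule field_le_epsilon)
  fix e :: real assume e: "e > 0"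
  define \<epsilon> where "\<epsilon> = e / 3"
  have eps: "\<epsilon> > 0" using e by (simp add: \<epsilon>_def)
  have sa: "star a = a" "star b = b"
    using assms by (auto simp: norm_positive_def star_diff)
  have "norm_positive ((norm b *\<^sub>R 1 - b) + (b - a))"
    by (intro norm_positive_add assms norm_positive_diff_scaleR_one sa order.refl)
  then have p: "norm_positive (norm b *\<^sub>R 1 - a)" by simp
  obtain r where r: "star r = r" "r * r = a + \<epsilon> *\<^sub>R 1" "\<forall>c. c * a = a * c \<longrightarrow> c * r = r * c"
    using norm_positive_sqrt_ex[OF assms(1) eps] by blast
  have "r * (a + \<epsilon> *\<^sub>R 1) = (a + \<epsilon> *\<^sub>R 1) * r"
    by (metis r(2) mult.assoc)
  then have ra: "r * a = a * r"
    by (simp add: algebra_simps)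
  obtain w where w: "star w = w" "w * w = (norm b *\<^sub>R 1 - a) + \<epsilon> *\<^sub>R 1"
    "\<forall>c. c * (norm b *\<^sub>R 1 - a) = (norm b *\<^sub>R 1 - a) * c \<longrightarrow> c * w = w * c"
    using norm_positive_sqrt_ex[OF p eps] by blast
  have "r * w = w * r"
    using w(3) ra by (simp add: algebra_simps)
  moreover have "r * r + w * w = (norm b + (\<epsilon> + \<epsilon>)) *\<^sub>R 1"
    unfolding r(2) w(2) scaleR_left_distrib by simp
  ultimately have "norm (r * r) \<le> \<bar>norm b + (\<epsilon> + \<epsilon>)\<bar>"
    using r(1) w(1) norm_sum_of_squares_le by blast
  moreover have "a = r * r + (- \<epsilon>) *\<^sub>R 1"
    by (simp add: r)
  ultimately have "norm a \<le> \<bar>norm b + (\<epsilon> + \<epsilon>)\<bar> + \<bar>-\<epsilon>\<bar>"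
    by (metis norm_triangle_mono norm_scaleR_one_le)
  then show "norm a \<le> norm b + e"
    using eps by (simp add: \<epsilon>_def)
qed

text \<open>Since \<open>l - a = (l + s) - (a + s)\<close>, it suffices to find a shift
  \<open>s\<close> with \<open>norm (a + s) < cmod (l + s)\<close>. For \<open>Re l \<le> 0\<close>
  the shift \<open>- norm a\<close> works by positivity; otherwise \<open>l\<close> is not real and
  an imaginary shift works by the C*-identity.\<close>

lemma norm_positive_imp_invertible:
  fixes a :: "'a::unital_cstar_algebra"
  assumes "norm_positive a" "l \<notin> complex_of_real ` {0..}"
  shows "alg_invertible (l *\<^sub>C 1 - a)"
proof -
  have sa: "star a = a" using assms by (simp add: norm_positive_def)
  have shift: ?thesis if "norm (a + s *\<^sub>C 1) < cmod (l + s)" for s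
  proof -
    have "l *\<^sub>C 1 - a = (l + s) *\<^sub>C 1 - (a + s *\<^sub>C 1)"
      by (simp add: scaleC_add_left)
    then show ?thesis using Neumann_invertible[OF that] by (simp only:)
  qed
  show ?thesis
  proof (cases "Re l \<le> 0")
    case True
    define t where "t = norm a"
    have "l \<noteq> 0" using assms(2) by auto
    then have l: "0 < (cmod l)\<^sup>2" by simp
    have "norm (a + complex_of_real (-t) *\<^sub>C 1) = norm (t *\<^sub>R 1 - a)"
      unfolding scaleC_of_real by (simp add: norm_minus_commute)
    also have "\<dots> \<le> t"
      using norm_positive_norm_le[OF assms(1)] by (simp add: t_def)
    also have "t < cmod (l + complex_of_real (-t))"
    proof (rule power2_less_imp_less)
      have "(cmod (l + complex_of_real (-t)))\<^sup>2 = (cmod l)\<^sup>2 - 2 * t * Re l + t\<^sup>2"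
        by (simp add: cmod_power2) (simp add: power2_eq_square algebra_simps)
      moreover have "t * Re l \<le> 0"
        using True by (simp add: t_def mult_nonneg_nonpos)
      ultimately show "t\<^sup>2 < (cmod (l + complex_of_real (-t)))\<^sup>2"
        using l by linarith
    qed simp
    finally show ?thesis by (rule shift)
  next
    case False
    then have im: "Im l \<noteq> 0"
      using assms(2) by (auto simp: image_iff complex_eq_iff)
    \<comment> \<open>Chosen so that the cross term \<open>2 * t * Im l\<close> of the square of
      \<open>cmod (l + \<i> * t)\<close> is twice the square of \<open>norm a\<close>, exceeding the
      single square in the bound for \<open>norm v\<close>.\<close>
    define t where "t = (norm a)\<^sup>2 / Im l"
    define v where "v = a + (\<i> * of_real t) *\<^sub>C 1"
    have "star v * v = a * a + t\<^sup>2 *\<^sub>R 1"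
      by (simp add: v_def star_add star_scaleC sa algebra_simps scaleC_mult_left scaleC_mult_right
          scaleC_scaleC scaleC_minus_left scaleC_diff_right scaleR_scaleC power2_eq_square)
    then have "(norm v)\<^sup>2 \<le> norm (a * a) + t\<^sup>2"
      using cstar_identity[of v] norm_scaleR_one_le[of "t\<^sup>2", where 'a='a]
        norm_triangle_ineq[of "a * a" "t\<^sup>2 *\<^sub>R 1"] by simp
    then have 1: "(norm v)\<^sup>2 \<le> (norm a)\<^sup>2 + t\<^sup>2"
      by (simp add: norm_selfadjoint_square sa)
    have "(cmod (l + \<i> * of_real t))\<^sup>2 = (cmod l)\<^sup>2 + 2 * (norm a)\<^sup>2 + t\<^sup>2"
      using im by (simp add: cmod_power2 t_def) (simp add: power2_eq_square field_simps)
    moreover have "(cmod l)\<^sup>2 > 0"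
      using im by auto
    moreover have "(norm a)\<^sup>2 \<ge> 0" by simp
    ultimately have "(norm v)\<^sup>2 < (cmod (l + \<i> * of_real t))\<^sup>2"
      using 1 by linarith
    then show ?thesis
      by (intro shift[of "\<i> * of_real t"]) (auto simp: v_def intro: power2_less_imp_less)
  qed
qed

text \<open>Here \<open>p - \<delta> = p (1 - \<delta> q)\<close> is a product of commuting positive
  elements. With \<open>p + \<epsilon>\<close> in place of \<open>p\<close> it is the square of
  \<open>r * w\<close>; closedness of the cone allows \<open>\<epsilon>\<close> to tend to
  0.\<close>

lemma norm_positive_shift_down:
  fixes p q :: "'a::unital_cstar_algebra"
  assumes p: "norm_positive p" and pq: "p * q = 1" "q * p = 1" and \<delta>: "\<delta> \<ge> 0" "\<delta> * norm q < 1"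
  shows "norm_positive (p - \<delta> *\<^sub>R 1)"
proof -
  have sp: "star p = p" using p by (simp add: norm_positive_def)
  \<comment> \<open>The inverse inherits commutation, so \<open>r\<close>, which commutes with
    \<open>p\<close>, also commutes with \<open>q\<close> and then with \<open>w\<close>.\<close>
  have comm_q: "c * q = q * c" if "c * p = p * c" for c
  proof -
    have "c * q = q * (p * c) * q" by (simp add: pq flip: mult.assoc)
    also have "\<dots> = q * c * (p * q)" by (simp add: mult.assoc flip: that)
    finally show ?thesis by (simp add: pq)
  qed
  have "star q * p = 1"
    using pq(1) sp by (metis star_mult star_one)
  then have sq: "star q = q"
    by (metis pq(1) mult.assoc mult_1_left mult_1_right)
  have "star (\<delta> *\<^sub>R q) = \<delta> *\<^sub>R q" "norm (\<delta> *\<^sub>R q) < 1"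
    using \<delta> by (simp_all add: star_scaleR sq)
  then obtain w where w: "star w = w" "w * w = 1 - \<delta> *\<^sub>R q"
    "\<forall>c. c * (\<delta> *\<^sub>R q) = (\<delta> *\<^sub>R q) * c \<longrightarrow> c * w = w * c"
    using selfadjoint_sqrt_ex by blast
  have *: "norm_positive ((p + \<epsilon> *\<^sub>R 1) * (1 - \<delta> *\<^sub>R q))" if eps: "\<epsilon> > 0" for \<epsilon>
  proof -
    obtain r where r: "star r = r" "r * r = p + \<epsilon> *\<^sub>R 1"
      using norm_positive_sqrt_ex[OF p eps] by blast
    have "r * (p + \<epsilon> *\<^sub>R 1) = (p + \<epsilon> *\<^sub>R 1) * r"
      by (metis r(2) mult.assoc)
    then have "r * p = p * r"
      by (simp add: algebra_simps)
    then have "r * (\<delta> *\<^sub>R q) = (\<delta> *\<^sub>R q) * r"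
      using comm_q by simp
    then have rw: "r * w = w * r"
      using w(3) by blast
    have "(r * w) * (r * w) = r * (w * r) * w"
      by (simp add: mult.assoc)
    also have "\<dots> = (r * r) * (w * w)"
      by (simp add: mult.assoc flip: rw)
    finally have "(r * w) * (r * w) = (p + \<epsilon> *\<^sub>R 1) * (1 - \<delta> *\<^sub>R q)"
      by (simp add: r w)
    moreover have "star (r * w) = r * w"
      by (simp add: star_mult r w rw)
    ultimately show ?thesis
      using norm_positive_square[of "r * w"] by simp
  qed
  have lim: "((\<lambda>\<epsilon>. (p + \<epsilon> *\<^sub>R 1) * (1 - \<delta> *\<^sub>R q)) \<longlongrightarrow> (p + 0 *\<^sub>R 1) * (1 - \<delta> *\<^sub>R q)) (at_right 0)"
    by (intro tendsto_intros)
  have "(p + 0 *\<^sub>R 1) * (1 - \<delta> *\<^sub>R q) \<in> {a. norm_positive a}"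
    by (rule Lim_in_closed_set[OF closed_norm_positive _ _ lim])
      (use * in \<open>auto simp: eventually_at_filter\<close>)
  then show ?thesis
    by (simp add: right_diff_distrib pq)
qed

text \<open>Take the least \<open>s \<ge> 0\<close> with \<open>a + s\<close> in the closed cone. If
  \<open>s > 0\<close>, then \<open>- s\<close> is outside the spectrum, \<open>a + s\<close> is
  invertible, and the cone condition survives a further shift down, against minimality.\<close>

lemma cstar_positive_imp_norm_positive:
  assumes "cstar_positive a"
  shows "norm_positive a"
proof -
  have sa: "star a = a" and sp: "spectrum a \<subseteq> complex_of_real ` {0..}"
    using assms by (auto simp: cstar_positive_def)
  define X where "X = {s. s \<ge> 0 \<and> norm_positive (a + s *\<^sub>R 1)}"
  have "closed X"
  proof -
    have "closed ((\<lambda>s::real. a + s *\<^sub>R 1) -` {a. norm_positive a})"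
      by (intro continuous_closed_vimage closed_norm_positive continuous_intros)
    then have "closed ({0..} \<inter> (\<lambda>s::real. a + s *\<^sub>R 1) -` {a. norm_positive a})"
      by blast
    also have "\<dots> = X" by (auto simp: X_def)
    finally show ?thesis .
  qed
  moreover have "norm a \<in> X"
    using norm_positive_diff_scaleR_one[of "-a" "norm a"] sa
    by (simp add: X_def star_minus add.commute)
  moreover have bdd: "bdd_below X"
    by (auto simp: X_def bdd_below_def)
  ultimately have "Inf X \<in> X"
    using closed_contains_Inf by blast
  define s where "s = Inf X"
  have s: "s \<ge> 0" "norm_positive (a + s *\<^sub>R 1)"
    using \<open>Inf X \<in> X\<close> by (auto simp: X_def s_def)
  have "s = 0"
  proof (rule ccontr)
    assume "s \<noteq> 0"
    then have "complex_of_real (- s) \<notin> spectrum a"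
      using sp s(1) by (auto simp del: of_real_minus)
    then have "alg_invertible (complex_of_real (- s) *\<^sub>C 1 - a)"
      by (simp add: spectrum_def)
    then obtain b where b: "(- s *\<^sub>R 1 - a) * b = 1" "b * (- s *\<^sub>R 1 - a) = 1"
      unfolding scaleC_of_real by (auto simp: alg_invertible_def)
    have q: "(a + s *\<^sub>R 1) * (- b) = 1" "(- b) * (a + s *\<^sub>R 1) = 1"
      using b by (simp_all add: algebra_simps)
    \<comment> \<open>The bound by \<open>s\<close> keeps \<open>s - \<delta>\<close> nonnegative;
      the other bound ensures \<open>\<delta> * norm (- b) < 1\<close>.\<close>
    define \<delta> where "\<delta> = min s (1 / (norm (- b) + 1))"
    have "\<delta> > 0"
      using \<open>s \<noteq> 0\<close> s by (simp add: \<delta>_def add_nonneg_pos)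
    have "\<delta> * norm (- b) \<le> 1 / (norm (- b) + 1) * norm (- b)"
      by (intro mult_right_mono) (auto simp: \<delta>_def)
    also have "\<dots> < 1"
      by (simp add: divide_less_eq add_nonneg_pos)
    finally have "norm_positive (a + s *\<^sub>R 1 - \<delta> *\<^sub>R 1)"
      using norm_positive_shift_down[OF s(2) q] \<open>\<delta> > 0\<close> by simp
    then have "s - \<delta> \<in> X"
      by (simp add: X_def \<delta>_def algebra_simps)
    then show False
      using cInf_lower[OF _ bdd] \<open>\<delta> > 0\<close> by (force simp: s_def)
  qed
  then show ?thesis using s by simp
qed

lemma cstar_positive_iff: "cstar_positive a \<longleftrightarrow> norm_positive a"
proof
  assume "norm_positive a"
  then show "cstar_positive a"
    using norm_positive_imp_invertible[of a]
    by (auto simp: cstar_positive_def norm_positive_def spectrum_def)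
qed (rule cstar_positive_imp_norm_positive)

lemma cstar_le_iff: "a \<preceq> b \<longleftrightarrow> norm_positive (b - a)"
  by (simp add: cstar_le_def cstar_positive_iff)

lemma strictly_nonzero_iff: "strictly_nonzero a \<longleftrightarrow> alg_invertible a"
proof -
  have "alg_invertible (- a) \<longleftrightarrow> alg_invertible a"
    unfolding alg_invertible_def by (metis minus_mult_commute minus_minus)
  then show ?thesis
    by (simp add: strictly_nonzero_def spectrum_def)
qed

lemma strictly_nonzero_scaleR_one: "r \<noteq> 0 \<Longrightarrow> strictly_nonzero (r *\<^sub>R (1::'a::unital_cstar_algebra))"
  unfolding strictly_nonzero_iff alg_invertible_def by (rule exI[of _ "inverse r *\<^sub>R 1"]) simp

text \<open>Brings a real bound \<open>M\<close> into the conjugation form demanded of frame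
  bounds.\<close>

lemma scaleR_one_conjugate:
  "M \<ge> 0 \<Longrightarrow> (sqrt M *\<^sub>R 1) * a * star (sqrt M *\<^sub>R 1) = M *\<^sub>R (a::'a::unital_cstar_algebra)"
  by (simp add: star_scaleR)

section \<open>Cauchy--Schwarz, unordered sums and uniform boundedness\<close>

text \<open>A discriminant argument: \<open>s = a / (6 * N)\<close> minimizes the right side minus
  the left. For \<open>N = 0\<close> a large \<open>s\<close> contradicts
  \<open>a > 0\<close>.\<close>

lemma norm_square_le_of_quadratic_bound:
  fixes a N M :: real
  assumes "\<And>s. s > 0 \<Longrightarrow> a * s \<le> 3 * (s\<^sup>2 * N + M)" "a \<ge> 0" "N \<ge> 0" "M \<ge> 0"
  shows "a\<^sup>2 \<le> 36 * N * M"
proof (cases "a = 0")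
  case False
  then have a: "a > 0" using assms(2) by simp
  show ?thesis
  proof (cases "N = 0")
    case True
    have "a * ((3 * M + 1) / a) \<le> 3 * M"
      using assms(1)[of "(3 * M + 1) / a"] True a assms(4) by (simp add: add_nonneg_pos)
    then show ?thesis using a by simp
  next
    case False
    then have N: "N > 0" using assms(3) by simp
    have "a * (a / (6 * N)) \<le> 3 * ((a / (6 * N))\<^sup>2 * N + M)"
      using assms(1)[of "a / (6 * N)"] a N by simp
    then have "a * (a / (6 * N)) * (12 * N) \<le> 3 * ((a / (6 * N))\<^sup>2 * N + M) * (12 * N)"
      using N by (intro mult_right_mono) auto
    then show ?thesis
      using N by (simp add: power2_eq_square field_simps)
  qed
qed (use assms in auto)

text \<open>The assumption is positivity of a form at \<open>c v + w\<close>, with \<open>P = \<langle>v, v\<rangle>\<close>, \<open>Q = \<langle>w, w\<rangle>\<close>, \<open>X = \<langle>v, w\<rangle>\<close>.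
  Any constant serves for the questions of convergence and boundedness below.\<close>

lemma positive_form_Cauchy_Schwarz:
  fixes P Q X :: "'a::unital_cstar_algebra"
  assumes pos: "\<And>c. norm_positive ((cmod c)\<^sup>2 *\<^sub>R P + c *\<^sub>C X + cnj c *\<^sub>C star X + Q)"
  shows "(norm X)\<^sup>2 \<le> 36 * norm P * norm Q"
proof (rule norm_square_le_of_quadratic_bound)
  fix s :: real assume s: "s > 0"
  define D where "D c = c *\<^sub>C X + cnj c *\<^sub>C star X" for c
  define G where "G = s\<^sup>2 *\<^sub>R P + Q"
  \<comment> \<open>Replacing \<open>c\<close> by \<open>- c\<close> flips the sign of
    \<open>D c\<close>, so \<open>G + D c\<close> lies between 0 and \<open>2 G\<close>;
    monotonicity of the norm applies.\<close>
  have D: "norm (D c) \<le> 3 * norm G" if c: "cmod c = s" for c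
  proof -
    have 1: "norm_positive (G + D c)"
      using pos[of c] c by (simp add: D_def G_def add_ac)
    have "norm_positive (G - D c)"
      using pos[of "- c"] c by (simp add: D_def G_def scaleC_minus_left algebra_simps)
    then have "norm_positive (2 *\<^sub>R G - (G + D c))"
      by (simp add: scaleR_2)
    then have "norm (G + D c) \<le> norm (2 *\<^sub>R G)"
      using norm_mono_positive 1 by blast
    then have "norm (G + D c) \<le> 2 * norm G" by simp
    then show ?thesis
      using norm_triangle_ineq4[of "G + D c" G] by simp
  qed
  \<comment> \<open>The values at \<open>s\<close> and \<open>\<i> * s\<close> are combined so that
    the \<open>star X\<close> terms cancel.\<close>
  have "D (of_real s) - \<i> *\<^sub>C D (\<i> * of_real s) = (2 * s) *\<^sub>R X"
    by (simp add: D_def scaleC_add_right scaleC_diff_right scaleC_scaleC scaleC_minus_left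
        scaleC_minus_right scaleC_of_real scaleR_2 flip: mult.assoc scaleR_scaleR)
  then have "norm ((2 * s) *\<^sub>R X) \<le> norm (D (of_real s)) + norm (D (\<i> * of_real s))"
    using norm_triangle_ineq4[of "D (of_real s)" "\<i> *\<^sub>C D (\<i> * of_real s)"] by (simp add: norm_scaleC)
  also have "\<dots> \<le> 6 * norm G"
    using D[of "of_real s"] D[of "\<i> * of_real s"] s by (simp add: norm_mult)
  also have "norm G \<le> s\<^sup>2 * norm P + norm Q"
    using norm_triangle_ineq[of "s\<^sup>2 *\<^sub>R P" Q] by (simp add: G_def)
  finally show "norm X * s \<le> 3 * (s\<^sup>2 * norm P + norm Q)"
    using s by (simp add: mult_ac)
qed auto

text \<open>Cauchy criterion for the net of finite sums: beyond some \<open>F0\<close> the sums of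
  \<open>g\<close> over \<open>F - F0\<close> are small, and the squared bound passes this on to
  \<open>f\<close>.\<close>

lemma summable_on_square_dominated:
  fixes f :: "'i \<Rightarrow> 'b::banach" and g :: "'i \<Rightarrow> 'c::real_normed_vector"
  assumes g: "g summable_on A"
    and dom: "\<And>F. finite F \<Longrightarrow> F \<subseteq> A \<Longrightarrow> (norm (sum f F))\<^sup>2 \<le> C * norm (sum g F)"
  shows "f summable_on A"
proof -
  obtain L where L: "(sum g \<longlongrightarrow> L) (finite_subsets_at_top A)"
    using g by (auto simp: summable_on_def has_sum_def)
  have "\<exists>P. eventually P (finite_subsets_at_top A) \<and>
              (\<forall>F F'. P F \<and> P F' \<longrightarrow> dist (sum f F) (sum f F') < e)" if e: "e > 0" for e
  proof -
    \<comment> \<open>Makes \<open>(\<bar>C\<bar> + 1) * 2 * d\<close> equal to one eighth of the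
      square of \<open>e\<close>, below the square of \<open>e / 2\<close>; the added 1 avoids
      division by zero.\<close>
    define d where "d = e\<^sup>2 / (16 * (\<bar>C\<bar> + 1))"
    have d: "d > 0" using e by (simp add: d_def)
    have "\<forall>\<^sub>F F in finite_subsets_at_top A. dist (sum g F) L < d"
      using L d by (rule tendstoD)
    then obtain F0 where "finite F0 \<and> F0 \<subseteq> A \<and>
        (\<forall>F. finite F \<and> F0 \<subseteq> F \<and> F \<subseteq> A \<longrightarrow> dist (sum g F) L < d)"
      unfolding eventually_finite_subsets_at_top by (rule exE)
    then have F0: "finite F0" "F0 \<subseteq> A"
      "\<And>F. finite F \<Longrightarrow> F0 \<subseteq> F \<Longrightarrow> F \<subseteq> A \<Longrightarrow> dist (sum g F) L < d"
      by simp_all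
    have small: "dist (sum f F) (sum f F0) < e / 2" if F: "finite F" "F0 \<subseteq> F" "F \<subseteq> A" for F
    proof -
      have "norm (sum g (F - F0)) = dist (sum g F) (sum g F0)"
        using F by (simp add: sum_diff dist_norm)
      also have "\<dots> < 2 * d"
        using F0(3)[OF F] F0(3)[of F0] F0(1,2) dist_triangle2[of "sum g F" "sum g F0" L] by simp
      finally have g: "norm (sum g (F - F0)) < 2 * d" .
      have "(norm (sum f (F - F0)))\<^sup>2 \<le> C * norm (sum g (F - F0))"
        using F by (intro dom) auto
      also have "\<dots> \<le> (\<bar>C\<bar> + 1) * norm (sum g (F - F0))"
        by (intro mult_right_mono) auto
      also have "\<dots> \<le> (\<bar>C\<bar> + 1) * (2 * d)"
        using g by (intro mult_left_mono) auto
      also have "\<dots> = e\<^sup>2 / 8"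
        by (simp add: d_def field_simps)
      also have "\<dots> < (e / 2)\<^sup>2"
        using e by (simp add: power2_eq_square)
      finally have "norm (sum f (F - F0)) < e / 2"
        by (rule power2_less_imp_less) (use e in simp)
      then show ?thesis
        using F by (simp add: sum_diff dist_norm)
    qed
    have "dist (sum f F) (sum f F') < e"
      if "finite F" "F0 \<subseteq> F" "F \<subseteq> A" "finite F'" "F0 \<subseteq> F'" "F' \<subseteq> A" for F F'
      using small[OF that(1-3)] small[OF that(4-6)] dist_triangle2[of "sum f F" "sum f F'" "sum f F0"]
      by simp
    moreover have "\<forall>\<^sub>F F in finite_subsets_at_top A. finite F \<and> F0 \<subseteq> F \<and> F \<subseteq> A"
      using F0 by (auto simp: eventually_finite_subsets_at_top intro!: exI[of _ F0])
    ultimately show ?thesis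
      by (intro exI[of _ "\<lambda>F. finite F \<and> F0 \<subseteq> F \<and> F \<subseteq> A"]) blast
  qed
  then have "cauchy_filter (filtermap (sum f) (finite_subsets_at_top A))"
    by (simp add: cauchy_filter_metric_filtermap)
  moreover have "complete (UNIV::'b set)"
    by (rule complete_UNIV)
  ultimately obtain L' where "(sum f \<longlongrightarrow> L') (finite_subsets_at_top A)"
    using complete_uniform[where S=UNIV] by (force simp add: filterlim_def)
  then show ?thesis
    using summable_on_def has_sum_def by blast
qed

text \<open>A limit of finite sums in the closed cone; for a family that is not summable,
  \<open>infsum\<close> is 0, which is in the cone too.\<close>

lemma norm_positive_infsum:
  assumes "\<And>i. i \<in> A \<Longrightarrow> norm_positive (f i)"
  shows "norm_positive (infsum f A)"
proof (cases "f summable_on A")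
  case True
  have "infsum f A \<in> {a. norm_positive a}"
  proof (rule Lim_in_closed_set[OF closed_norm_positive _ _ infsum_tendsto[OF True]])
    show "\<forall>\<^sub>F F in finite_subsets_at_top A. sum f F \<in> {a. norm_positive a}"
      by (rule eventually_finite_subsets_at_top_weakI) (use assms norm_positive_sum in blast)
  qed simp
  then show ?thesis by simp
qed (simp add: infsum_not_exists)

lemma norm_sum_le_norm_infsum:
  assumes "f summable_on A" "\<And>i. i \<in> A \<Longrightarrow> norm_positive (f i)" "finite F" "F \<subseteq> A"
  shows "norm (sum f F) \<le> norm (infsum f A)"
proof (rule norm_mono_positive)
  show "norm_positive (sum f F)"
    using assms by (intro norm_positive_sum) auto
  have "infsum f A - sum f F = infsum f (A - F)"
    using assms by (subst infsum_Diff) auto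
  also have "norm_positive \<dots>"
    using assms by (intro norm_positive_infsum) auto
  finally show "norm_positive (infsum f A - sum f F)" .
qed

text \<open>By Baire one of the closed sets \<open>G n\<close> contains a ball around some
  \<open>a\<close>. Then \<open>f i y = f i (a + y) - f i a\<close> is bounded by
  \<open>2 * n\<close> on vectors \<open>y\<close> of norm \<open>e\<close>, and scaling gives all
  \<open>x\<close>.\<close>

lemma uniform_boundedness:
  fixes f :: "'i \<Rightarrow> 'b::banach \<Rightarrow> 'c::real_normed_vector"
  assumes lin: "\<And>i. i \<in> A \<Longrightarrow> bounded_linear (f i)"
    and bdd: "\<And>x. \<exists>M. \<forall>i\<in>A. norm (f i x) \<le> M"
  shows "\<exists>M\<ge>0. \<forall>i\<in>A. \<forall>x. norm (f i x) \<le> M * norm x"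
proof -
  define G where "G n = (\<Inter>i\<in>A. {x. norm (f i x) \<le> real n})" for n :: nat
  have closed: "closed (G n)" for n
    unfolding G_def by (intro closed_INT ballI closed_Collect_le continuous_intros
        linear_continuous_on lin)
  have UN: "(\<Union>n. G n) = UNIV"
  proof -
    have "\<exists>n. x \<in> G n" for x
    proof -
      obtain M where M: "\<forall>i\<in>A. norm (f i x) \<le> M" using bdd by blast
      obtain n where "M \<le> real n" using real_arch_simple by blast
      then show ?thesis using M unfolding G_def by (auto intro: order.trans)
    qed
    then show ?thesis by blast
  qed
  have "\<exists>n. interior (G n) \<noteq> {}"
  proof (rule ccontr)
    assume "\<not> ?thesis"
    then have "euclidean interior_of \<Union>(range G) = {}"
      using closed by (intro Baire_category_alt) (auto simp: completely_metrizable_space_euclidean)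
    then show False using UN by simp
  qed
  then obtain n a where "a \<in> interior (G n)" by blast
  then obtain e where e: "e > 0" "cball a e \<subseteq> G n"
    unfolding mem_interior_cball by blast
  have "norm (f i x) \<le> (2 * real n / e) * norm x" if i: "i \<in> A" for i x
  proof (cases "x = 0")
    case True
    then show ?thesis using bounded_linear.linear[OF lin[OF i]] by (simp add: linear_0)
  next
    case False
    define y where "y = (e / norm x) *\<^sub>R x"
    have "a + y \<in> cball a e" "a \<in> cball a e"
      using e(1) False by (auto simp: y_def dist_norm)
    then have "a + y \<in> G n" "a \<in> G n"
      using e(2) by auto
    then have 1: "norm (f i (a + y)) \<le> n" "norm (f i a) \<le> n"
      using i by (simp_all add: G_def)
    have "f i y = f i (a + y) - f i a"
      using bounded_linear.linear[OF lin[OF i]] by (simp add: linear_add)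
    then have "norm (f i y) \<le> 2 * real n"
      using 1 norm_triangle_ineq4[of "f i (a + y)" "f i a"] by simp
    moreover have "norm (f i y) = (e / norm x) * norm (f i x)"
      using bounded_linear.linear[OF lin[OF i]] e(1) by (simp add: y_def linear_scale)
    ultimately show ?thesis
      using e(1) False by (simp add: field_simps)
  qed
  then show ?thesis
    using e(1) by (intro exI[of _ "2 * real n / e"]) auto
qed

section \<open>Operators on Hilbert modules\<close>

context hilbert_cstar_module
begin

section \<open>Rules for the inner product and its Cauchy--Schwarz inequality\<close>

lemma ip_scaleC_left: "ip (c *\<^sub>C x) y = c *\<^sub>C ip x y"
proof -
  have "c *\<^sub>C x = (c *\<^sub>C 1) \<odot> x"
    by (simp add: act_scaleC_left act_one)
  then show ?thesis
    by (simp add: ip_act_left scaleC_mult_left)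
qed

lemma ip_add_right: "ip x (y + z) = ip x y + ip x z"
  by (metis ip_star ip_add_left star_add)

lemma ip_scaleC_right: "ip x (c *\<^sub>C y) = cnj c *\<^sub>C ip x y"
  by (metis ip_star ip_scaleC_left star_scaleC)

lemma ip_act_right: "ip x (a \<odot> y) = ip x y * star a"
  by (metis ip_star ip_act_left star_mult)

lemma ip_scaleR_left: "ip (r *\<^sub>R x) y = r *\<^sub>R ip x y"
  by (simp add: scaleR_scaleC ip_scaleC_left)

lemma ip_scaleR_right: "ip x (r *\<^sub>R y) = r *\<^sub>R ip x y"
  by (simp add: scaleR_scaleC ip_scaleC_right)

lemma ip_minus_left: "ip (- x) y = - ip x y"
  using ip_scaleR_left[of "-1" x y] by simp

lemma ip_minus_right: "ip x (- y) = - ip x y"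
  using ip_scaleR_right[of x "-1" y] by simp

lemma ip_diff_left: "ip (x - y) z = ip x z - ip y z"
  using ip_add_left[of x "-y" z] by (simp add: ip_minus_left)

lemma ip_diff_right: "ip x (y - z) = ip x y - ip x z"
  using ip_add_right[of x y "-z"] by (simp add: ip_minus_right)

lemma ip_zero_left [simp]: "ip 0 y = 0"
  using ip_scaleR_left[of 0 0 y] by simp

lemma ip_zero_right [simp]: "ip x 0 = 0"
  using ip_scaleR_right[of x 0 0] by simp

lemma ip_sum_left: "ip (sum f F) y = (\<Sum>i\<in>F. ip (f i) y)"
  by (induction F rule: infinite_finite_induct) (auto simp: ip_add_left)

lemma norm_positive_ip [simp]: "norm_positive (ip x x)"
  using ip_positive cstar_positive_iff by blast

lemma norm_ip_self: "norm (ip x x) = (norm x)\<^sup>2"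
  by (simp add: norm_ip)

lemma ip_ext_left: "(\<And>z. ip x z = ip y z) \<Longrightarrow> x = y"
  using ip_definite[of "x - y"] by (simp add: ip_diff_left)

lemma ip_ext_right: "(\<And>z. ip z x = ip z y) \<Longrightarrow> x = y"
  using ip_definite[of "x - y"] by (simp add: ip_diff_right)

text \<open>Positivity of the summed form at \<open>c f + g\<close> is the hypothesis of
  \<open>positive_form_Cauchy_Schwarz\<close>. Finite sums control convergence in \<open>l2\<close>;
  a single summand gives the bound on \<open>ip\<close>.\<close>

lemma finite_Cauchy_Schwarz:
  "(norm (\<Sum>i\<in>F. ip (f i) (g i)))\<^sup>2 \<le> 36 * norm (\<Sum>i\<in>F. ip (f i) (f i)) * norm (\<Sum>i\<in>F. ip (g i) (g i))"
proof (rule positive_form_Cauchy_Schwarz)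
  fix c
  have "norm_positive (\<Sum>i\<in>F. ip (c *\<^sub>C f i + g i) (c *\<^sub>C f i + g i))"
    by (intro norm_positive_sum) simp
  also have "(\<Sum>i\<in>F. ip (c *\<^sub>C f i + g i) (c *\<^sub>C f i + g i)) =
     (\<Sum>i\<in>F. (cmod c)\<^sup>2 *\<^sub>R ip (f i) (f i) + c *\<^sub>C ip (f i) (g i) + cnj c *\<^sub>C ip (g i) (f i) + ip (g i) (g i))"
    by (simp add: ip_add_left ip_add_right ip_scaleC_left ip_scaleC_right scaleC_scaleC
        scaleR_scaleC complex_norm_square[symmetric] mult.commute add_ac scaleC_add_right)
  also have "\<dots> = (cmod c)\<^sup>2 *\<^sub>R (\<Sum>i\<in>F. ip (f i) (f i)) + c *\<^sub>C (\<Sum>i\<in>F. ip (f i) (g i)) +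
        cnj c *\<^sub>C star (\<Sum>i\<in>F. ip (f i) (g i)) + (\<Sum>i\<in>F. ip (g i) (g i))"
  proof -
    have "c *\<^sub>C sum h F = (\<Sum>i\<in>F. c *\<^sub>C h i)" for c :: complex and h :: "_ \<Rightarrow> 'a"
      by (induction F rule: infinite_finite_induct) (auto simp: scaleC_add_right)
    then show ?thesis
      by (simp add: sum.distrib scaleR_sum_right star_sum ip_star)
  qed
  finally show "norm_positive \<dots>" .
qed

lemma norm_ip_le: "norm (ip x y) \<le> 6 * norm x * norm y"
proof (rule power2_le_imp_le)
  show "(norm (ip x y))\<^sup>2 \<le> (6 * norm x * norm y)\<^sup>2"
    using finite_Cauchy_Schwarz[of "\<lambda>_. x" "\<lambda>_. y" "{()}"]
    by (simp add: norm_ip_self power_mult_distrib)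
qed simp

lemma bounded_linear_ip_left: "bounded_linear (\<lambda>x. ip x y)"
  by (rule bounded_linear_intro[where K="6 * norm y"])
    (use norm_ip_le[of _ y] in \<open>auto simp: ip_add_left ip_scaleR_left mult_ac\<close>)

lemma bounded_linear_ip_right: "bounded_linear (ip x)"
  by (rule bounded_linear_intro[where K="6 * norm x"])
    (use norm_ip_le[of x] in \<open>auto simp: ip_add_right ip_scaleR_right mult_ac\<close>)

lemma norm_act_le: "norm (a \<odot> x) \<le> norm a * norm x"
proof (rule power2_le_imp_le)
  have "(norm (a \<odot> x))\<^sup>2 = norm (a * (ip x x * star a))"
    by (simp add: norm_ip_self[symmetric] ip_act_left ip_act_right mult.assoc)
  also have "\<dots> \<le> norm a * (norm (ip x x) * norm (star a))"
    by (meson norm_mult_ineq mult_left_mono norm_ge_zero order.trans)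
  finally show "(norm (a \<odot> x))\<^sup>2 \<le> (norm a * norm x)\<^sup>2"
    by (simp add: norm_ip_self power2_eq_square mult_ac)
qed simp

text \<open>Definiteness of \<open>ip\<close> makes the description in \<open>adj\<close> unique, so
  any vector with the adjoint property is the adjoint's value.\<close>

lemma adj_unique:
  assumes "\<And>z. ipW (T z) y = ip z x"
  shows "adj ip ipW T y = x"
  unfolding adj_def using assms ip_ext_right by (intro the_equality) metis+

lemma adj_eq:
  assumes "is_adjointable ip W ipW T" "y \<in> W"
  shows "ipW (T z) y = ip z (adj ip ipW T y)"
proof -
  obtain T' where "\<And>x y. y \<in> W \<Longrightarrow> ipW (T x) y = ip x (T' y)"
    using assms(1) by (auto simp: is_adjointable_def)
  then show ?thesis
    using adj_unique[of ipW T y "T' y"] assms(2) by metis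
qed

lemma adjointableI: "(\<And>x y. ip (T x) y = ip x (T' y)) \<Longrightarrow> adjointable ip T"
  unfolding is_adjointable_def by blast

text \<open>Linearity is tested against all vectors through \<open>ip\<close>. The maps
  \<open>ip x (T' y)\<close> of \<open>x\<close>, for \<open>y\<close> in the unit ball, are
  pointwise bounded because they equal \<open>ip (T x) y\<close>; uniform boundedness and the choice
  \<open>y = T x / norm (T x)\<close> bound \<open>T\<close>.\<close>

lemma adjointable_bounded_linear:
  assumes T: "adjointable ip T"
  shows "bounded_linear T"
proof -
  obtain T' where T': "\<And>x y. ip (T x) y = ip x (T' y)"
    using T by (auto simp: is_adjointable_def)
  have add: "T (x + y) = T x + T y" for x y
    by (rule ip_ext_left) (simp add: T' ip_add_left)
  have scale: "T (r *\<^sub>R x) = r *\<^sub>R T x" for r x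
    by (rule ip_ext_left) (simp add: T' ip_scaleR_left)
  have "\<exists>M\<ge>0. \<forall>y\<in>cball 0 1. \<forall>x. norm (ip x (T' y)) \<le> M * norm x"
  proof (rule uniform_boundedness)
    fix x
    have "norm (ip x (T' y)) \<le> 6 * norm (T x)" if "y \<in> cball 0 1" for y
    proof -
      have "norm (ip (T x) y) \<le> 6 * norm (T x) * norm y"
        by (rule norm_ip_le)
      also have "\<dots> \<le> 6 * norm (T x)"
        using that by (intro mult_left_le) auto
      finally show ?thesis by (simp add: T')
    qed
    then show "\<exists>M. \<forall>y\<in>cball 0 1. norm (ip x (T' y)) \<le> M"
      by blast
  qed (rule bounded_linear_ip_left)
  then obtain M where M: "M \<ge> 0" "\<And>x y. norm y \<le> 1 \<Longrightarrow> norm (ip (T x) y) \<le> M * norm x"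
    by (auto simp: T')
  have "norm (T x) \<le> norm x * M" for x
  proof (cases "T x = 0")
    case False
    define y where "y = (1 / norm (T x)) *\<^sub>R T x"
    have "norm (ip (T x) y) \<le> M * norm x"
      using False by (intro M) (simp add: y_def)
    moreover have "norm (ip (T x) y) = norm (T x)"
      using False by (simp add: y_def ip_scaleR_right norm_ip_self power2_eq_square)
    ultimately show ?thesis by (simp add: mult.commute)
  qed (use M in auto)
  then show ?thesis
    by (intro bounded_linear_intro[of T M] add scale)
qed

text \<open>Iterating \<open>2 \<langle>Q x, x\<rangle> \<le> \<langle>x, x\<rangle> + \<langle>Q\<^sup>2 x, x\<rangle>\<close> gives \<open>\<langle>Q x, x\<rangle> \<le> \<langle>x, x\<rangle>\<close> for symmetric contractions
  without functional calculus.\<close>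

lemma symmetric_contraction_iterate:
  assumes "\<And>x y. ip (Q x) y = ip x (Q y)" "\<And>x. norm (Q x) \<le> norm x"
  shows "\<exists>e. norm e \<le> 6 * (norm x)\<^sup>2 / 2 ^ k \<and> norm_positive ((1 - 1 / 2 ^ k) *\<^sub>R ip x x + e - ip (Q x) x)"
  using assms
proof (induction k arbitrary: Q)
  case 0
  have "norm (ip (Q x) x) \<le> 6 * norm (Q x) * norm x"
    by (rule norm_ip_le)
  also have "\<dots> \<le> 6 * norm x * norm x"
    using 0(2) by (intro mult_right_mono mult_left_mono) auto
  finally show ?case
    \<comment> \<open>At \<open>k = 0\<close> the coefficient of \<open>ip x x\<close> vanishes, so
      the error term absorbs all of \<open>ip (Q x) x\<close>.\<close>
    by (intro exI[of _ "ip (Q x) x"]) (simp add: power2_eq_square)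
next
  case (Suc k)
  have "norm ((Q \<circ> Q) y) \<le> norm y" for y
    using Suc.prems(2)[of y] Suc.prems(2)[of "Q y"] by simp
  then obtain e where e: "norm e \<le> 6 * (norm x)\<^sup>2 / 2 ^ k"
    "norm_positive ((1 - 1 / 2 ^ k) *\<^sub>R ip x x + e - ip ((Q \<circ> Q) x) x)"
    using Suc.IH[of "Q \<circ> Q"] Suc.prems(1) by auto
  have "norm_positive (ip (x - Q x) (x - Q x))"
    by simp
  then have "norm_positive (ip x x - 2 *\<^sub>R ip (Q x) x + ip (Q (Q x)) x)"
    by (simp add: ip_diff_left ip_diff_right Suc.prems(1) scaleR_2 algebra_simps)
  then have "norm_positive ((1 / 2) *\<^sub>R ((1 - 1 / 2 ^ k) *\<^sub>R ip x x + e - ip ((Q \<circ> Q) x) x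
       + (ip x x - 2 *\<^sub>R ip (Q x) x + ip (Q (Q x)) x)))"
    by (intro norm_positive_scaleR[OF norm_positive_add[OF e(2)]]) simp_all
  also have "(1 / 2) *\<^sub>R ((1 - 1 / 2 ^ k) *\<^sub>R ip x x + e - ip ((Q \<circ> Q) x) x
       + (ip x x - 2 *\<^sub>R ip (Q x) x + ip (Q (Q x)) x))
     = (1 - 1 / 2 ^ Suc k) *\<^sub>R ip x x + (1 / 2) *\<^sub>R e - ip (Q x) x"
  proof -
    have "(1 - 1 / 2 ^ Suc k) *\<^sub>R ip x x = (1 / 2) *\<^sub>R ((1 - 1 / 2 ^ k) *\<^sub>R ip x x + ip x x)"
      by (simp add: algebra_simps) (simp flip: scaleR_left_distrib)
    then show ?thesis
      by (simp add: scaleR_add_right scaleR_diff_right)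
  qed
  finally show ?case
    using e(1) by (intro exI[of _ "(1 / 2) *\<^sub>R e"]) simp
qed

text \<open>The limit of the iteration: the coefficient tends to 1, the error to 0, and the cone is
  closed.\<close>

lemma symmetric_contraction_le:
  assumes "\<And>x y. ip (Q x) y = ip x (Q y)" "\<And>x. norm (Q x) \<le> norm x"
  shows "norm_positive (ip x x - ip (Q x) x)"
proof -
  obtain e where e: "\<And>k. norm (e k) \<le> 6 * (norm x)\<^sup>2 / 2 ^ k"
    "\<And>k. norm_positive ((1 - 1 / 2 ^ k) *\<^sub>R ip x x + e k - ip (Q x) x)"
    using symmetric_contraction_iterate[OF assms] by metis
  have h: "(\<lambda>k. 1 / 2 ^ k :: real) \<longlonglongrightarrow> 0"
    using LIMSEQ_power_zero[of "1/2::real"] by (simp add: power_one_over)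
  have "e \<longlonglongrightarrow> 0"
  proof (rule Lim_null_comparison)
    show "\<forall>\<^sub>F k in sequentially. norm (e k) \<le> 6 * (norm x)\<^sup>2 * (1 / 2 ^ k)"
      using e(1) by simp
    show "(\<lambda>k. 6 * (norm x)\<^sup>2 * (1 / 2 ^ k)) \<longlonglongrightarrow> 0"
      using tendsto_mult_right_zero[OF h] by blast
  qed
  then have "(\<lambda>k. (1 - 1 / 2 ^ k) *\<^sub>R ip x x + e k - ip (Q x) x) \<longlonglongrightarrow> (1 - 0) *\<^sub>R ip x x + 0 - ip (Q x) x"
    by (intro tendsto_intros h)
  then have "(1 - 0) *\<^sub>R ip x x + 0 - ip (Q x) x \<in> {a. norm_positive a}"
    by (rule closed_sequentially[OF closed_norm_positive, rotated]) (simp add: e(2))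
  then show ?thesis by simp
qed

text \<open>Symmetry makes \<open>P\<close> adjointable, hence bounded; dividing by a norm bound
  \<open>M\<close> reduces to contractions.\<close>

lemma symmetric_le:
  assumes sym: "\<And>x y. ip (P x) y = ip x (P y)"
  shows "\<exists>M>0. \<forall>x. norm_positive (M *\<^sub>R ip x x - ip (P x) x)"
proof -
  have "bounded_linear P"
    using sym by (intro adjointable_bounded_linear adjointableI)
  then obtain M where M: "M > 0" "\<And>x. norm (P x) \<le> norm x * M"
    using bounded_linear.pos_bounded by blast
  have "norm_positive (M *\<^sub>R ip x x - ip (P x) x)" for x
  proof -
    have "norm_positive (M *\<^sub>R (ip x x - ip ((1 / M) *\<^sub>R P x) x))"
      using M by (intro norm_positive_scaleR symmetric_contraction_le[of "\<lambda>x. (1 / M) *\<^sub>R P x"])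
        (auto simp: ip_scaleR_left ip_scaleR_right sym divide_le_eq)
    then show ?thesis
      using M by (simp add: ip_scaleR_left scaleR_diff_right)
  qed
  then show ?thesis using M by blast
qed

text \<open>Surjectivity of \<open>P\<close> is reached by descending from \<open>P + t\<close> with large \<open>t\<close>: positivity makes the
  lower bound of \<open>P + t\<close>, hence the admissible step, independent of \<open>t\<close>.\<close>

lemma positive_bounded_below_bij:
  assumes sym: "\<And>x y. ip (P x) y = ip x (P y)"
    and pos: "\<And>x. norm_positive (ip (P x) x)"
    and below: "c > 0" "\<And>x. c * (norm x)\<^sup>2 \<le> norm (ip (P x) x)"
  shows "bij P"
proof -
  have bl: "bounded_linear P"
    using sym by (intro adjointable_bounded_linear adjointableI)
  interpret bounded_linear P by (rule bl)
  obtain M where M: "M > 0" "\<And>x. norm (P x) \<le> norm x * M"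
    using pos_bounded by blast
  \<comment> \<open>The 6 is the constant in \<open>norm_ip_le\<close>.\<close>
  define \<delta> where "\<delta> = c / 6"
  have \<delta>: "\<delta> > 0" using below by (simp add: \<delta>_def)
  define R where "R t x = P x + t *\<^sub>R x" for t x
  have lower: "\<delta> * norm x \<le> norm (R t x)" if "t \<ge> 0" for t x
  proof (cases "x = 0")
    case False
    have "c * (norm x)\<^sup>2 \<le> norm (ip (P x) x)"
      by (rule below)
    also have "\<dots> \<le> norm (ip (R t x) x)"
      using that by (intro norm_mono_positive pos)
        (simp add: R_def ip_add_left ip_scaleR_left norm_positive_scaleR)
    also have "\<dots> \<le> 6 * norm (R t x) * norm x"
      by (rule norm_ip_le)
    finally show ?thesis
      using False by (simp add: power2_eq_square \<delta>_def)
  qed simp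
  have Rdiff: "R t x - R t y = R t (x - y)" for t x y
    by (simp add: R_def diff algebra_simps)
  \<comment> \<open>For \<open>t > M\<close> the equation \<open>R t x = y\<close> reads
    \<open>x = (y - P x) / t\<close>, a contraction with constant \<open>M / t\<close>.\<close>
  have start: "surj (R t)" if t: "t > M" for t
  proof -
    have t0: "t > 0" using t M by simp
    have "\<exists>x. R t x = y" for y
    proof -
      have "\<exists>!x. (1 / t) *\<^sub>R (y - P x) = x"
      proof (rule banach_fix_type[of "M / t"])
        show "\<forall>u v. dist ((1 / t) *\<^sub>R (y - P u)) ((1 / t) *\<^sub>R (y - P v)) \<le> M / t * dist u v"
        proof (intro allI)
          fix u v
          have "dist ((1 / t) *\<^sub>R (y - P u)) ((1 / t) *\<^sub>R (y - P v)) = norm (P (v - u)) / t"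
            using t0 by (simp add: dist_norm diff flip: scaleR_diff_right)
          also have "\<dots> \<le> (norm (v - u) * M) / t"
            using t0 M by (intro divide_right_mono) auto
          finally show "dist ((1 / t) *\<^sub>R (y - P u)) ((1 / t) *\<^sub>R (y - P v)) \<le> M / t * dist u v"
            by (simp add: dist_norm norm_minus_commute mult.commute)
        qed
      qed (use t t0 M in auto)
      then obtain x where x: "(1 / t) *\<^sub>R (y - P x) = x" by auto
      have "t *\<^sub>R x = y - P x"
        using t0 by (subst x[symmetric]) simp
      then show ?thesis by (intro exI[of _ x]) (simp add: R_def)
    qed
    then show ?thesis by (metis surjI)
  qed
  \<comment> \<open>A fixed point of \<open>g (y + s x)\<close> as a function of \<open>x\<close>
    solves \<open>R (t - s) x = y\<close>. By the lower bound \<open>g\<close> has Lipschitz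
    constant \<open>1 / \<delta>\<close>, so \<open>s < \<delta>\<close> suffices.\<close>
  have step: "surj (R (t - s))" if surj: "surj (R t)" and t: "t \<ge> 0" and s: "0 \<le> s" "s < \<delta>" for t s
  proof -
    define g where "g = inv (R t)"
    have Rg: "R t (g u) = u" for u
      using surj by (simp add: g_def surj_f_inv_f)
    have gd: "norm (g u - g v) \<le> norm (u - v) / \<delta>" for u v
      using lower[OF t, of "g u - g v"] \<delta> by (simp add: Rg field_simps flip: Rdiff)
    have "\<exists>x. R (t - s) x = y" for y
    proof -
      have "\<exists>!x. g (y + s *\<^sub>R x) = x"
      proof (rule banach_fix_type[of "s / \<delta>"])
        show "\<forall>u v. dist (g (y + s *\<^sub>R u)) (g (y + s *\<^sub>R v)) \<le> s / \<delta> * dist u v"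
          using gd[of "y + s *\<^sub>R _" "y + s *\<^sub>R _"] s(1)
          by (simp add: dist_norm flip: scaleR_diff_right)
      qed (use s \<delta> in auto)
      then obtain x where "g (y + s *\<^sub>R x) = x" by auto
      then have "R t x = y + s *\<^sub>R x"
        using Rg[of "y + s *\<^sub>R x"] by simp
      then show ?thesis
        by (intro exI[of _ x]) (simp add: R_def algebra_simps)
    qed
    then show ?thesis by (metis surjI)
  qed
  \<comment> \<open>Steps of length \<open>\<delta> / 2\<close>, below the admissible
    \<open>\<delta>\<close>, lead from some \<open>N * (\<delta> / 2) > M\<close> down to 0.\<close>
  obtain N :: nat where N: "M < real N * (\<delta> / 2)"
    using reals_Archimedean3[of "\<delta> / 2"] \<delta> by auto
  have "k \<le> N \<Longrightarrow> surj (R (real (N - k) * (\<delta> / 2)))" for k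
  proof (induction k)
    case 0
    then show ?case using start[OF N] by simp
  next
    case (Suc k)
    have "real (N - k) * (\<delta> / 2) - \<delta> / 2 = real (N - Suc k) * (\<delta> / 2)"
      using Suc.prems by (simp add: of_nat_diff field_simps)
    moreover have "surj (R (real (N - k) * (\<delta> / 2) - \<delta> / 2))"
      using Suc \<delta> by (intro step) auto
    ultimately show ?case
      by (simp only:)
  qed
  from this[of N] have "surj (R 0)" by simp
  moreover have "R 0 = P" by (auto simp: R_def)
  moreover have "inj P"
  proof (rule injI)
    fix x y assume "P x = P y"
    then have "\<delta> * norm (x - y) \<le> 0"
      using lower[of 0 "x - y"] by (simp add: R_def diff)
    then show "x = y" using \<delta> by (simp add: mult_le_0_iff)
  qed
  ultimately show ?thesis by (simp add: bij_def)
qed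

section \<open>The module \<open>l\<^sup>2(H)\<close>\<close>

text \<open>Cauchy--Schwarz with the total sum for \<open>f\<close> as constant makes the series for
  \<open>g\<close> dominate.\<close>

lemma l2_ip_has_sum:
  assumes "f \<in> l2 I ip" "g \<in> l2 I ip"
  shows "((\<lambda>i. ip (f i) (g i)) has_sum l2_ip I ip f g) I"
proof -
  let ?C = "36 * norm (\<Sum>\<^sub>\<infinity>i\<in>I. ip (f i) (f i))"
  have f: "(\<lambda>i. ip (f i) (f i)) summable_on I" and g: "(\<lambda>i. ip (g i) (g i)) summable_on I"
    using assms by (auto simp: l2_def)
  have "(\<lambda>i. ip (f i) (g i)) summable_on I"
  proof (rule summable_on_square_dominated[OF g, of _ ?C])
    fix F assume F: "finite F" "F \<subseteq> I"
    show "(norm (\<Sum>i\<in>F. ip (f i) (g i)))\<^sup>2 \<le> ?C * norm (\<Sum>i\<in>F. ip (g i) (g i))"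
      using norm_sum_le_norm_infsum[OF f _ F]
      by (intro order.trans[OF finite_Cauchy_Schwarz] mult_right_mono) auto
  qed
  then show ?thesis
    by (simp add: l2_ip_def)
qed

text \<open>The values 1 and -1 of \<open>r\<close> give closure under sums and differences; the
  expansion serves the lower bound for right inverses.\<close>

lemma
  assumes f: "f \<in> l2 I ip" and g: "g \<in> l2 I ip"
  shows l2_add_scaleR: "(\<lambda>i. f i + r *\<^sub>R g i) \<in> l2 I ip"
    and l2_ip_add_scaleR_self: "l2_ip I ip (\<lambda>i. f i + r *\<^sub>R g i) (\<lambda>i. f i + r *\<^sub>R g i) =
      l2_ip I ip f f + r *\<^sub>R (l2_ip I ip f g + l2_ip I ip g f) + r\<^sup>2 *\<^sub>R l2_ip I ip g g"
proof -
  have "((\<lambda>i. ip (f i) (f i) + r *\<^sub>R (ip (f i) (g i) + ip (g i) (f i)) + r\<^sup>2 *\<^sub>R ip (g i) (g i)) has_sum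
      l2_ip I ip f f + r *\<^sub>R (l2_ip I ip f g + l2_ip I ip g f) + r\<^sup>2 *\<^sub>R l2_ip I ip g g) I"
    by (intro has_sum_add has_sum_scaleR l2_ip_has_sum f g)
  also have "(\<lambda>i. ip (f i) (f i) + r *\<^sub>R (ip (f i) (g i) + ip (g i) (f i)) + r\<^sup>2 *\<^sub>R ip (g i) (g i))
      = (\<lambda>i. ip (f i + r *\<^sub>R g i) (f i + r *\<^sub>R g i))"
    by (simp add: ip_add_left ip_add_right ip_scaleR_left ip_scaleR_right power2_eq_square
        scaleR_add_right add_ac)
  finally have *: "((\<lambda>i. ip (f i + r *\<^sub>R g i) (f i + r *\<^sub>R g i)) has_sum
      l2_ip I ip f f + r *\<^sub>R (l2_ip I ip f g + l2_ip I ip g f) + r\<^sup>2 *\<^sub>R l2_ip I ip g g) I" .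
  then show "(\<lambda>i. f i + r *\<^sub>R g i) \<in> l2 I ip"
    using f g by (auto simp: l2_def dest: has_sum_imp_summable)
  show "l2_ip I ip (\<lambda>i. f i + r *\<^sub>R g i) (\<lambda>i. f i + r *\<^sub>R g i) =
      l2_ip I ip f f + r *\<^sub>R (l2_ip I ip f g + l2_ip I ip g f) + r\<^sup>2 *\<^sub>R l2_ip I ip g g"
    using * by (simp add: l2_ip_def infsumI)
qed

lemma l2_add: "f \<in> l2 I ip \<Longrightarrow> g \<in> l2 I ip \<Longrightarrow> f + g \<in> l2 I ip"
  using l2_add_scaleR[of f I g 1] by (simp add: plus_fun_def)

lemma l2_diff: "f \<in> l2 I ip \<Longrightarrow> g \<in> l2 I ip \<Longrightarrow> f - g \<in> l2 I ip"
  using l2_add_scaleR[of f I g "-1"] by (simp add: fun_diff_def)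

lemma l2_ip_star:
  assumes "f \<in> l2 I ip" "g \<in> l2 I ip"
  shows "star (l2_ip I ip f g) = l2_ip I ip g f"
proof -
  have "((\<lambda>i. star (ip (f i) (g i))) has_sum star (l2_ip I ip f g)) I"
    by (intro has_sum_bounded_linear[OF bounded_linear_star] l2_ip_has_sum assms)
  then show ?thesis
    by (simp add: ip_star l2_ip_def infsumI)
qed

lemma l2_ip_add_scaleR_left:
  assumes "f \<in> l2 I ip" "g \<in> l2 I ip" "h \<in> l2 I ip"
  shows "l2_ip I ip (\<lambda>i. f i + r *\<^sub>R g i) h = l2_ip I ip f h + r *\<^sub>R l2_ip I ip g h"
proof -
  have "((\<lambda>i. ip (f i) (h i) + r *\<^sub>R ip (g i) (h i)) has_sum l2_ip I ip f h + r *\<^sub>R l2_ip I ip g h) I"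
    by (intro has_sum_add has_sum_scaleR l2_ip_has_sum assms)
  then show ?thesis
    by (simp add: l2_ip_def ip_add_left ip_scaleR_left infsumI)
qed

lemma l2_ip_add_left:
  "f \<in> l2 I ip \<Longrightarrow> g \<in> l2 I ip \<Longrightarrow> h \<in> l2 I ip \<Longrightarrow>
    l2_ip I ip (f + g) h = l2_ip I ip f h + l2_ip I ip g h"
  using l2_ip_add_scaleR_left[of f I g h 1] by (simp add: plus_fun_def)

lemma l2_ip_diff_left:
  "f \<in> l2 I ip \<Longrightarrow> g \<in> l2 I ip \<Longrightarrow> h \<in> l2 I ip \<Longrightarrow>
    l2_ip I ip (f - g) h = l2_ip I ip f h - l2_ip I ip g h"
  using l2_ip_add_scaleR_left[of f I g h "-1"] by (simp add: fun_diff_def)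

lemma l2_ip_add_right:
  assumes "f \<in> l2 I ip" "g \<in> l2 I ip" "h \<in> l2 I ip"
  shows "l2_ip I ip h (f + g) = l2_ip I ip h f + l2_ip I ip h g"
proof -
  have "star (l2_ip I ip (f + g) h) = star (l2_ip I ip f h) + star (l2_ip I ip g h)"
    by (simp add: assms l2_ip_add_left star_add)
  then show ?thesis
    by (simp add: assms l2_ip_star l2_add)
qed

lemma l2_ip_diff_right:
  assumes "f \<in> l2 I ip" "g \<in> l2 I ip" "h \<in> l2 I ip"
  shows "l2_ip I ip h (f - g) = l2_ip I ip h f - l2_ip I ip h g"
proof -
  have "star (l2_ip I ip (f - g) h) = star (l2_ip I ip f h) - star (l2_ip I ip g h)"
    by (simp add: assms l2_ip_diff_left star_diff)
  then show ?thesis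
    by (simp add: assms l2_ip_star l2_diff)
qed

lemma norm_positive_l2_ip [simp]: "norm_positive (l2_ip I ip f f)"
  unfolding l2_ip_def by (intro norm_positive_infsum) simp

section \<open>Adjointable maps into \<open>l2\<close> and their composites\<close>

lemma adjointable_l2D:
  assumes "adjointable_l2 I ip T"
  shows "T x \<in> l2 I ip" "f \<in> l2 I ip \<Longrightarrow> l2_ip I ip (T z) f = ip z (adj_l2 I ip T f)"
  using adj_eq[OF assms] assms by (auto simp: is_adjointable_def)

lemma adjointable_l2D':
  assumes T: "adjointable_l2 I ip T" and f: "f \<in> l2 I ip"
  shows "l2_ip I ip f (T z) = ip (adj_l2 I ip T f) z"
proof -
  have "star (l2_ip I ip (T z) f) = star (ip z (adj_l2 I ip T f))"
    by (simp add: adjointable_l2D(2)[OF T f])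
  then show ?thesis
    by (simp add: l2_ip_star adjointable_l2D(1)[OF T] f ip_star)
qed

lemma adjointable_l2I:
  assumes "\<And>x. T x \<in> l2 I ip" "\<And>z f. f \<in> l2 I ip \<Longrightarrow> l2_ip I ip (T z) f = ip z (T' f)"
  shows "adjointable_l2 I ip T"
  using assms unfolding is_adjointable_def by blast

lemma adj_l2_add:
  assumes "adjointable_l2 I ip T" "f \<in> l2 I ip" "g \<in> l2 I ip"
  shows "adj_l2 I ip T (f + g) = adj_l2 I ip T f + adj_l2 I ip T g"
  by (rule adj_unique)
    (simp add: l2_ip_add_right adjointable_l2D[OF assms(1)] assms(2,3) ip_add_right)

lemma adj_l2_diff:
  assumes "adjointable_l2 I ip T" "f \<in> l2 I ip" "g \<in> l2 I ip"
  shows "adj_l2 I ip T (f - g) = adj_l2 I ip T f - adj_l2 I ip T g"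
  by (rule adj_unique)
    (simp add: l2_ip_diff_right adjointable_l2D[OF assms(1)] assms(2,3) ip_diff_right)

lemma adjointable_l2_add:
  assumes "adjointable_l2 I ip T" "adjointable_l2 I ip U"
  shows "adjointable_l2 I ip (T + U)"
  by (rule adjointable_l2I[where T'="\<lambda>f. adj_l2 I ip T f + adj_l2 I ip U f"])
    (simp_all add: l2_add l2_ip_add_left adjointable_l2D[OF assms(1)] adjointable_l2D[OF assms(2)]
      ip_add_right)

lemma adjointable_l2_diff:
  assumes "adjointable_l2 I ip T" "adjointable_l2 I ip U"
  shows "adjointable_l2 I ip (T - U)"
  by (rule adjointable_l2I[where T'="\<lambda>f. adj_l2 I ip T f - adj_l2 I ip U f"])
    (simp_all add: l2_diff l2_ip_diff_left adjointable_l2D[OF assms(1)] adjointable_l2D[OF assms(2)]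
      ip_diff_right)

lemma adjointable_l2_comp:
  assumes "adjointable_l2 I ip T" "adjointable ip Q"
  shows "adjointable_l2 I ip (T \<circ> Q)"
  by (rule adjointable_l2I[where T'="adj_H ip Q \<circ> adj_l2 I ip T"])
    (simp_all add: adjointable_l2D[OF assms(1)] adj_eq[OF assms(2)])

lemma adjointable_adj_l2_comp:
  assumes T: "adjointable_l2 I ip T" and U: "adjointable_l2 I ip U"
  shows "adjointable ip (adj_l2 I ip T \<circ> U)"
  by (rule adjointableI[where T'="adj_l2 I ip U \<circ> T"])
    (simp add: adjointable_l2D'[OF T, symmetric] adjointable_l2D[OF T] adjointable_l2D[OF U])

lemma adjointable_comp:
  assumes "adjointable ip P" "adjointable ip Q"
  shows "adjointable ip (P \<circ> Q)"
  by (rule adjointableI[where T'="adj_H ip Q \<circ> adj_H ip P"])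
    (simp add: adj_eq[OF assms(1)] adj_eq[OF assms(2)])

text \<open>Apply \<open>symmetric_le\<close> to the composite of \<open>T\<close> with its
  adjoint.\<close>

lemma adjointable_l2_le:
  assumes T: "adjointable_l2 I ip T"
  shows "\<exists>M>0. \<forall>x. norm_positive (M *\<^sub>R ip x x - l2_ip I ip (T x) (T x))"
proof -
  have "\<exists>M>0. \<forall>x. norm_positive (M *\<^sub>R ip x x - ip ((adj_l2 I ip T \<circ> T) x) x)"
    by (rule symmetric_le)
      (simp add: adjointable_l2D'[OF T, symmetric] adjointable_l2D(2)[OF T, symmetric]
        adjointable_l2D(1)[OF T])
  then show ?thesis
    by (simp add: adjointable_l2D'[OF T, symmetric] adjointable_l2D(1)[OF T])
qed

text \<open>With \<open>T\<^sup>*T \<le> M\<close>, the lower bound comes from expanding \<open>0 \<le> \<langle>(U - T/M) x, (U - T/M) x\<rangle>\<close>.\<close>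

lemma right_inverse_bounded_below:
  assumes T: "adjointable_l2 I ip T" and U: "adjointable_l2 I ip U"
    and TU: "adj_l2 I ip T \<circ> U = id"
  shows "\<exists>m>0. \<forall>x. norm_positive (l2_ip I ip (U x) (U x) - m *\<^sub>R ip x x)"
proof -
  obtain M where M: "M > 0" "\<And>x. norm_positive (M *\<^sub>R ip x x - l2_ip I ip (T x) (T x))"
    using adjointable_l2_le[OF T] by blast
  have "norm_positive (l2_ip I ip (U x) (U x) - (1 / M) *\<^sub>R ip x x)" for x
  proof -
    have l: "U x \<in> l2 I ip" "T x \<in> l2 I ip"
      using T U by (simp_all add: adjointable_l2D)
    have [simp]: "adj_l2 I ip T (U x) = x"
      using TU by (metis comp_apply id_apply)
    have "l2_ip I ip (T x) (U x) = ip x x" "l2_ip I ip (U x) (T x) = ip x x"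
      using l by (simp_all add: adjointable_l2D[OF T] adjointable_l2D'[OF T])
    then have "norm_positive (l2_ip I ip (U x) (U x) + (- (1 / M)) *\<^sub>R (ip x x + ip x x)
        + (- (1 / M))\<^sup>2 *\<^sub>R l2_ip I ip (T x) (T x))"
      using l2_ip_add_scaleR_self[OF l, of "- (1 / M)"] norm_positive_l2_ip by metis
    \<comment> \<open>The added term trades the form of \<open>T\<close> for
      \<open>(1 / M) ip x x\<close>, so the total coefficient of \<open>ip x x\<close> becomes
      \<open>- 2 / M + 1 / M\<close>.\<close>
    then have "norm_positive (l2_ip I ip (U x) (U x) + (- (1 / M)) *\<^sub>R (ip x x + ip x x)
        + (- (1 / M))\<^sup>2 *\<^sub>R l2_ip I ip (T x) (T x)
        + (1 / M)\<^sup>2 *\<^sub>R (M *\<^sub>R ip x x - l2_ip I ip (T x) (T x)))"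
      by (rule norm_positive_add) (intro norm_positive_scaleR M zero_le_power2)
    then show ?thesis
      using M(1) by (simp add: scaleR_diff_right scaleR_add_right power2_eq_square)
  qed
  then show ?thesis
    using M(1) by (intro exI[of _ "1 / M"]) auto
qed

text \<open>Pairing with the family that is \<open>y\<close> at \<open>i\<close> and 0 elsewhere
  extracts the coordinate, so the adjoint applies that of \<open>T\<close> to this family.\<close>

lemma adjointable_coord:
  assumes T: "adjointable_l2 I ip T" and i: "i \<in> I"
  shows "adjointable ip (coord i \<circ> T)"
proof (rule adjointableI[where T'="\<lambda>y. adj_l2 I ip T (\<lambda>j. if j = i then y else 0)"])
  fix x y :: 'h
  let ?e = "\<lambda>j. if j = i then y else 0"
  have "(\<lambda>j. ip (?e j) (?e j)) summable_on I"
    by (rule finite_nonzero_values_imp_summable_on) (rule finite_subset[of _ "{i}"], auto)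
  then have e: "?e \<in> l2 I ip"
    using i by (auto simp: l2_def)
  have "l2_ip I ip (T x) ?e = infsum (\<lambda>j. ip (T x j) (?e j)) {i}"
    unfolding l2_ip_def using i by (intro infsum_cong_neutral) auto
  then have "ip (T x i) y = l2_ip I ip (T x) ?e"
    by simp
  also have "\<dots> = ip x (adj_l2 I ip T ?e)"
    by (rule adjointable_l2D(2)[OF T e])
  finally show "ip ((coord i \<circ> T) x) y = ip x (adj_l2 I ip T ?e)"
    by (simp add: coord_def)
qed

section \<open>Frames and their transforms\<close>

lemma frame_imp_bessel: "star_operator_frame I ip T \<Longrightarrow> star_operator_bessel I ip T"
  unfolding star_operator_frame_def star_operator_bessel_def by blast

lemma frame_transform_l2:
  assumes "star_operator_bessel I ip T"
  shows "frame_transform I T x \<in> l2 I ip"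
proof -
  have "(\<lambda>i. ip (T i x) (T i x)) summable_on I"
    using assms by (simp add: star_operator_bessel_def)
  also have "(\<lambda>i. ip (T i x) (T i x)) summable_on I \<longleftrightarrow>
      (\<lambda>i. ip (frame_transform I T x i) (frame_transform I T x i)) summable_on I"
    by (intro summable_on_cong) (simp add: frame_transform_def)
  finally show ?thesis
    by (simp add: l2_def frame_transform_def)
qed

lemma l2_ip_frame_transform:
  "l2_ip I ip (frame_transform I T x) (frame_transform I T x) = (\<Sum>\<^sub>\<infinity>i\<in>I. ip (T i x) (T i x))"
  unfolding l2_ip_def by (intro infsum_cong) (simp add: frame_transform_def)

text \<open>Conjugation by \<open>B\<close> is the form at \<open>B \<odot> x\<close>, whose norm is
  at most \<open>norm B * norm x\<close>.\<close>

lemma bessel_norm_bound: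
  assumes "star_operator_bessel I ip T"
  shows "\<exists>K\<ge>0. \<forall>x. norm (\<Sum>\<^sub>\<infinity>i\<in>I. ip (T i x) (T i x)) \<le> K * (norm x)\<^sup>2"
proof -
  obtain B where B: "\<And>x. (\<Sum>\<^sub>\<infinity>i\<in>I. ip (T i x) (T i x)) \<preceq> B * ip x x * star B"
    using assms by (auto simp: star_operator_bessel_def)
  have "norm (\<Sum>\<^sub>\<infinity>i\<in>I. ip (T i x) (T i x)) \<le> (norm B)\<^sup>2 * (norm x)\<^sup>2" for x
  proof -
    have "norm (\<Sum>\<^sub>\<infinity>i\<in>I. ip (T i x) (T i x)) \<le> norm (B * ip x x * star B)"
      using B[of x] by (intro norm_mono_positive norm_positive_infsum) (auto simp: cstar_le_iff)
    also have "\<dots> = (norm (B \<odot> x))\<^sup>2"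
      by (simp add: norm_ip_self[symmetric] ip_act_left ip_act_right mult.assoc)
    also have "\<dots> \<le> (norm B * norm x)\<^sup>2"
      by (intro power_mono norm_act_le) simp
    finally show ?thesis
      by (simp add: power_mult_distrib)
  qed
  then show ?thesis
    by (intro exI[of _ "(norm B)\<^sup>2"]) auto
qed

text \<open>For a finite partial sum \<open>h\<close>, \<open>ip h h\<close> is the sum of
  \<open>ip (f i) (T i h)\<close>. Cauchy--Schwarz and the Bessel bound control the fourth power of
  \<open>norm h\<close> by a multiple of its square, which cancels.\<close>

lemma bessel_synthesis:
  assumes T: "star_operator_bessel I ip T" and f: "f \<in> l2 I ip"
  shows "(\<lambda>i. adj_H ip (T i) (f i)) summable_on I"
proof -
  obtain K where K: "K \<ge> 0" "\<And>x. norm (\<Sum>\<^sub>\<infinity>i\<in>I. ip (T i x) (T i x)) \<le> K * (norm x)\<^sup>2"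
    using bessel_norm_bound[OF T] by blast
  have summ: "(\<lambda>i. ip (T i x) (T i x)) summable_on I" for x
    using T by (simp add: star_operator_bessel_def)
  have "(\<lambda>i. ip (f i) (f i)) summable_on I"
    using f by (simp add: l2_def)
  then show ?thesis
  proof (rule summable_on_square_dominated)
    fix F assume F: "finite F" "F \<subseteq> I"
    define h where "h = (\<Sum>i\<in>F. adj_H ip (T i) (f i))"
    have adj: "ip (adj_H ip (T i) y) z = ip y (T i z)" if "i \<in> F" for i y z
    proof -
      have "adjointable ip (T i)"
        using T F that by (auto simp: star_operator_bessel_def)
      then have "ip (T i z) y = ip z (adj_H ip (T i) y)"
        by (rule adj_eq) simp
      then show ?thesis by (metis ip_star)
    qed
    have "ip h h = (\<Sum>i\<in>F. ip (adj_H ip (T i) (f i)) h)"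
      by (subst (1) h_def) (rule ip_sum_left)
    also have "\<dots> = (\<Sum>i\<in>F. ip (f i) (T i h))"
      by (intro sum.cong refl adj)
    finally have "((norm h)\<^sup>2)\<^sup>2 \<le> 36 * norm (\<Sum>i\<in>F. ip (f i) (f i)) * norm (\<Sum>i\<in>F. ip (T i h) (T i h))"
      using finite_Cauchy_Schwarz[where F=F and f=f and g="\<lambda>i. T i h"] norm_ip_self[of h] by simp
    also have "\<dots> \<le> 36 * norm (\<Sum>i\<in>F. ip (f i) (f i)) * (K * (norm h)\<^sup>2)"
      using norm_sum_le_norm_infsum[OF summ[of h] _ F] K(2)[of h] K(1) by (intro mult_left_mono) auto
    finally have le: "(norm h)\<^sup>2 * (norm h)\<^sup>2 \<le> (36 * K * norm (\<Sum>i\<in>F. ip (f i) (f i))) * (norm h)\<^sup>2"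
      by (simp add: power2_eq_square mult_ac)
    have "(norm h)\<^sup>2 \<le> 36 * K * norm (\<Sum>i\<in>F. ip (f i) (f i))"
    proof (cases "h = 0")
      case False
      then show ?thesis
        by (intro mult_right_le_imp_le[OF le]) simp
    qed (simp add: K(1))
    then show "(norm (\<Sum>i\<in>F. adj_H ip (T i) (f i)))\<^sup>2 \<le> 36 * K * norm (\<Sum>i\<in>F. ip (f i) (f i))"
      by (simp add: h_def)
  qed
qed

text \<open>Continuity of \<open>ip z\<close> moves it through the synthesis series, which is
  thereby identified as the adjoint of the transform.\<close>

lemma
  assumes T: "star_operator_bessel I ip T"
  shows adjointable_frame_transform: "adjointable_l2 I ip (frame_transform I T)"
    and has_sum_adj_frame_transform: "f \<in> l2 I ip \<Longrightarrow>
      ((\<lambda>i. adj_H ip (T i) (f i)) has_sum adj_l2 I ip (frame_transform I T) f) I"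
proof -
  have *: "l2_ip I ip (frame_transform I T z) f = ip z (\<Sum>\<^sub>\<infinity>i\<in>I. adj_H ip (T i) (f i))"
    if f: "f \<in> l2 I ip" for f z
  proof -
    have "((\<lambda>i. ip z (adj_H ip (T i) (f i))) has_sum ip z (\<Sum>\<^sub>\<infinity>i\<in>I. adj_H ip (T i) (f i))) I"
      by (intro has_sum_bounded_linear[OF bounded_linear_ip_right] has_sum_infsum
          bessel_synthesis[OF T] f)
    then have "ip z (\<Sum>\<^sub>\<infinity>i\<in>I. adj_H ip (T i) (f i)) = (\<Sum>\<^sub>\<infinity>i\<in>I. ip z (adj_H ip (T i) (f i)))"
      by (simp add: infsumI)
    also have "\<dots> = l2_ip I ip (frame_transform I T z) f"
      unfolding l2_ip_def
    proof (rule infsum_cong)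
      fix i assume i: "i \<in> I"
      then have "adjointable ip (T i)"
        using T by (auto simp: star_operator_bessel_def)
      then show "ip z (adj_H ip (T i) (f i)) = ip (frame_transform I T z i) (f i)"
        using i adj_eq[of UNIV ip "T i" "f i" z] by (simp add: frame_transform_def)
    qed
    finally show ?thesis ..
  qed
  then show "adjointable_l2 I ip (frame_transform I T)"
    using frame_transform_l2[OF T] by (intro adjointable_l2I)
  show "((\<lambda>i. adj_H ip (T i) (f i)) has_sum adj_l2 I ip (frame_transform I T) f) I" if f: "f \<in> l2 I ip"
  proof -
    have "adj_l2 I ip (frame_transform I T) f = (\<Sum>\<^sub>\<infinity>i\<in>I. adj_H ip (T i) (f i))"
      by (rule adj_unique) (rule *[OF f])
    then show ?thesis
      using bessel_synthesis[OF T f] by simp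
  qed
qed

lemma frame_operator_eq:
  assumes "star_operator_bessel I ip T"
  shows "frame_operator I ip T = adj_l2 I ip (frame_transform I T) \<circ> frame_transform I T"
proof
  fix x
  have "adj_l2 I ip (frame_transform I T) (frame_transform I T x) =
      (\<Sum>\<^sub>\<infinity>i\<in>I. adj_H ip (T i) (frame_transform I T x i))"
    by (intro infsumI[symmetric] has_sum_adj_frame_transform frame_transform_l2 assms)
  also have "\<dots> = frame_operator I ip T x"
    unfolding frame_operator_def by (intro infsum_cong) (simp add: frame_transform_def)
  finally show "frame_operator I ip T x = (adj_l2 I ip (frame_transform I T) \<circ> frame_transform I T) x"
    by simp
qed

text \<open>The form of the frame operator is the middle series. A left inverse \<open>b\<close> of
  the lower bound \<open>A\<close> gives \<open>norm x \<le> norm b * norm (A \<odot> x)\<close>, so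
  the form is bounded below in norm. The inverse is again symmetric.\<close>

lemma
  assumes T: "star_operator_frame I ip T"
  shows bij_frame_operator: "bij (frame_operator I ip T)"
    and adjointable_inv_frame_operator: "adjointable ip (inv (frame_operator I ip T))"
proof -
  let ?\<theta> = "frame_transform I T" and ?S = "frame_operator I ip T"
  note bes = frame_imp_bessel[OF T]
  note \<theta> = adjointable_frame_transform[OF bes]
  have S: "?S x = adj_l2 I ip ?\<theta> (?\<theta> x)" for x
    by (simp add: frame_operator_eq[OF bes])
  have sym: "ip (?S x) y = ip x (?S y)" for x y
    by (simp add: S adjointable_l2D'[OF \<theta>, symmetric] adjointable_l2D(2)[OF \<theta>, symmetric]
        adjointable_l2D(1)[OF \<theta>])
  have form: "ip (?S x) x = (\<Sum>\<^sub>\<infinity>i\<in>I. ip (T i x) (T i x))" for x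
    by (simp add: S adjointable_l2D'[OF \<theta>, symmetric] adjointable_l2D(1)[OF \<theta>] l2_ip_frame_transform)
  obtain A where A: "strictly_nonzero A"
    "\<And>x. A * ip x x * star A \<preceq> (\<Sum>\<^sub>\<infinity>i\<in>I. ip (T i x) (T i x))"
    using T by (auto simp: star_operator_frame_def)
  obtain b where b: "b * A = 1"
    using A(1) by (auto simp: strictly_nonzero_iff alg_invertible_def)
  \<comment> \<open>The added 1 keeps the denominator positive even if \<open>b = 0\<close>, as
    happens in the zero algebra.\<close>
  define c where "c = 1 / ((norm b)\<^sup>2 + 1)"
  have b1: "(norm b)\<^sup>2 + 1 > 0"
    by (simp add: add_nonneg_pos)
  show bij: "bij ?S"
  proof (rule positive_bounded_below_bij[OF sym])
    show "norm_positive (ip (?S x) x)" for x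
      unfolding form by (intro norm_positive_infsum) simp
    show "c > 0"
      using b1 by (simp add: c_def)
    show "c * (norm x)\<^sup>2 \<le> norm (ip (?S x) x)" for x
    proof -
      have "norm x \<le> norm b * norm (A \<odot> x)"
        using norm_act_le[of b "A \<odot> x"] by (simp add: b act_one flip: act_mult)
      then have "(norm x)\<^sup>2 \<le> (norm b * norm (A \<odot> x))\<^sup>2"
        by (intro power_mono) auto
      also have "\<dots> \<le> ((norm b)\<^sup>2 + 1) * (norm (A \<odot> x))\<^sup>2"
        by (simp add: power_mult_distrib distrib_right)
      finally have "c * (norm x)\<^sup>2 \<le> (norm (A \<odot> x))\<^sup>2"
        using b1 by (simp add: c_def divide_le_eq mult.commute)
      also have "\<dots> = norm (A * ip x x * star A)"
        by (simp add: norm_ip_self[symmetric] ip_act_left ip_act_right mult.assoc)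
      also have "\<dots> \<le> norm (ip (?S x) x)"
      proof (rule norm_mono_positive)
        have "norm_positive (ip (A \<odot> x) (A \<odot> x))" by simp
        then show "norm_positive (A * ip x x * star A)"
          by (simp only: ip_act_left ip_act_right mult.assoc)
        show "norm_positive (ip (?S x) x - A * ip x x * star A)"
          using A(2)[of x] by (simp add: form cstar_le_iff)
      qed
      finally show ?thesis .
    qed
  qed
  show "adjointable ip (inv ?S)"
  proof (rule adjointableI)
    show "ip (inv ?S x) y = ip x (inv ?S y)" for x y
      using sym[of "inv ?S x" "inv ?S y"] bij by (simp add: bij_is_surj surj_f_inv_f)
  qed
qed

text \<open>The bounds of \<open>adjointable_l2_le\<close> and
  \<open>right_inverse_bounded_below\<close> become scalar frame bounds, and the reconstruction
  formula is the synthesis series at \<open>\<eta> x\<close>. Families vanishing off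
  \<open>I\<close> make the transform equal to \<open>\<eta>\<close> exactly.\<close>

lemma
  assumes \<Lambda>: "star_operator_frame I ip \<Lambda>" and \<eta>: "adjointable_l2 I ip \<eta>"
    and inverse: "adj_l2 I ip (frame_transform I \<Lambda>) \<circ> \<eta> = id"
  shows dual_frame_right_inverse: "dual_star_operator_frame I ip \<Lambda> (\<lambda>i. coord i \<circ> \<eta>)"
    and frame_transform_coord: "frame_transform I (\<lambda>i. coord i \<circ> \<eta>) = \<eta>"
proof -
  note bes = frame_imp_bessel[OF \<Lambda>]
  note \<theta> = adjointable_frame_transform[OF bes]
  have \<eta>l2: "\<eta> x \<in> l2 I ip" for x
    by (rule adjointable_l2D[OF \<eta>])
  show "frame_transform I (\<lambda>i. coord i \<circ> \<eta>) = \<eta>"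
    using \<eta>l2 by (auto simp: frame_transform_def coord_def l2_def fun_eq_iff)
  have form: "(\<Sum>\<^sub>\<infinity>i\<in>I. ip ((coord i \<circ> \<eta>) x) ((coord i \<circ> \<eta>) x)) = l2_ip I ip (\<eta> x) (\<eta> x)" for x
    by (simp add: l2_ip_def coord_def)
  obtain M where M: "M > 0" "\<And>x. norm_positive (M *\<^sub>R ip x x - l2_ip I ip (\<eta> x) (\<eta> x))"
    using adjointable_l2_le[OF \<eta>] by blast
  obtain m where m: "m > 0" "\<And>x. norm_positive (l2_ip I ip (\<eta> x) (\<eta> x) - m *\<^sub>R ip x x)"
    using right_inverse_bounded_below[OF \<theta> \<eta> inverse] by blast
  have "star_operator_frame I ip (\<lambda>i. coord i \<circ> \<eta>)"
    unfolding star_operator_frame_def form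
  proof (intro conjI exI allI ballI)
    show "adjointable ip (coord i \<circ> \<eta>)" if "i \<in> I" for i
      using \<eta> that by (rule adjointable_coord)
    show "(\<lambda>i. ip ((coord i \<circ> \<eta>) x) ((coord i \<circ> \<eta>) x)) summable_on I" for x
      using \<eta>l2[of x] by (simp add: l2_def coord_def)
    show "strictly_nonzero (sqrt m *\<^sub>R (1::'a))" "strictly_nonzero (sqrt M *\<^sub>R (1::'a))"
      using m M by (auto intro: strictly_nonzero_scaleR_one)
    show "(sqrt m *\<^sub>R 1) * ip x x * star (sqrt m *\<^sub>R 1) \<preceq> l2_ip I ip (\<eta> x) (\<eta> x)" for x
      using m by (simp add: scaleR_one_conjugate cstar_le_iff del: mult_scaleR_left mult_scaleR_right)
    show "l2_ip I ip (\<eta> x) (\<eta> x) \<preceq> (sqrt M *\<^sub>R 1) * ip x x * star (sqrt M *\<^sub>R 1)" for x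
      using M by (simp add: scaleR_one_conjugate cstar_le_iff del: mult_scaleR_left mult_scaleR_right)
  qed
  moreover have "((\<lambda>i. adj_H ip (\<Lambda> i) ((coord i \<circ> \<eta>) x)) has_sum x) I" for x
  proof -
    have "adj_l2 I ip (frame_transform I \<Lambda>) (\<eta> x) = x"
      using inverse by (metis comp_apply id_apply)
    then show ?thesis
      using has_sum_adj_frame_transform[OF bes \<eta>l2[of x]] by (simp add: coord_def)
  qed
  ultimately show "dual_star_operator_frame I ip \<Lambda> (\<lambda>i. coord i \<circ> \<eta>)"
    using \<Lambda> by (simp add: dual_star_operator_frame_def)
qed

end

section \<open>The six statements on dual frames and right inverses\<close>

theorem theorem2p5:
  fixes act :: "'a::unital_cstar_algebra \<Rightarrow> 'h::complex_banach \<Rightarrow> 'h"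
    and ip :: "'h \<Rightarrow> 'h \<Rightarrow> 'a"
    and I :: "'i set"
    and \<Lambda> \<Omega> \<Lambda>t :: "'i \<Rightarrow> 'h \<Rightarrow> 'h"
    and \<theta> \<eta> :: "'h \<Rightarrow> 'i \<Rightarrow> 'h"
    and S :: "'h \<Rightarrow> 'h"
  assumes module: "hilbert_cstar_module act ip"
    and I: "countable I"
    and \<Lambda>: "star_operator_frame I ip \<Lambda>"
    and \<theta>: "\<theta> = frame_transform I \<Lambda>"
    and S: "S = frame_operator I ip \<Lambda>"
    and \<Lambda>t: "\<Lambda>t = canonical_dual I ip \<Lambda>"
    and \<Omega>: "dual_star_operator_frame I ip \<Lambda> \<Omega>"
    and \<eta>: "\<eta> = frame_transform I \<Omega>"
  shows
    "adj_l2 I ip \<theta> \<circ> \<eta> = id \<and>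
     (\<forall>i\<in>I. \<Omega> i = coord i \<circ> \<eta>) \<and>
     (\<forall>\<eta>'. adjointable_l2 I ip \<eta>' \<and> adj_l2 I ip \<theta> \<circ> \<eta>' = id \<longrightarrow>
        dual_star_operator_frame I ip \<Lambda> (\<lambda>i. coord i \<circ> \<eta>') \<and>
        frame_transform I (\<lambda>i. coord i \<circ> \<eta>') = \<eta>') \<and>
     frame_operator I ip \<Omega> =
        inv S + (adj_l2 I ip \<eta> \<circ> (id - (\<theta> \<circ> inv S \<circ> adj_l2 I ip \<theta>)) \<circ> \<eta>) \<and>
     ((\<forall>\<eta>'. adjointable_l2 I ip \<eta>' \<and> adj_l2 I ip \<theta> \<circ> \<eta>' = id \<longrightarrow>
         (\<exists>\<psi>. adjointable_l2 I ip \<psi> \<and>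
            \<eta>' = (\<theta> \<circ> inv S) + ((id - (\<theta> \<circ> inv S \<circ> adj_l2 I ip \<theta>)) \<circ> \<psi>))) \<and>
      (\<forall>\<psi> \<eta>'. adjointable_l2 I ip \<psi> \<and>
            \<eta>' = (\<theta> \<circ> inv S) + ((id - (\<theta> \<circ> inv S \<circ> adj_l2 I ip \<theta>)) \<circ> \<psi>) \<longrightarrow>
         adjointable_l2 I ip \<eta>' \<and> adj_l2 I ip \<theta> \<circ> \<eta>' = id)) \<and>
     (\<exists>\<Delta>. star_operator_bessel I ip \<Delta> \<and> frame_transform I \<Delta> = \<eta> \<and>
        (\<forall>i\<in>I. \<forall>x. (\<lambda>k. \<Lambda>t i (adj_H ip (\<Lambda> k) (\<Delta> k x))) summable_on I \<and>
           \<Omega> i x = \<Lambda>t i x + \<Delta> i x - (\<Sum>\<^sub>\<infinity>k\<in>I. \<Lambda>t i (adj_H ip (\<Lambda> k) (\<Delta> k x)))))"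
proof -
  interpret hilbert_cstar_module act ip by (rule module)
  note bessel_\<Lambda> = frame_imp_bessel[OF \<Lambda>]
  have frame_\<Omega>: "star_operator_frame I ip \<Omega>"
    and sum_\<Omega>: "\<And>x. ((\<lambda>i. adj_H ip (\<Lambda> i) (\<Omega> i x)) has_sum x) I"
    using \<Omega> by (auto simp: dual_star_operator_frame_def)
  note bessel_\<Omega> = frame_imp_bessel[OF frame_\<Omega>]
  have adj_\<theta>: "adjointable_l2 I ip \<theta>" and adj_\<eta>: "adjointable_l2 I ip \<eta>"
    unfolding \<theta> \<eta> by (intro adjointable_frame_transform bessel_\<Lambda> bessel_\<Omega>)+
  have \<theta>l2 [simp]: "\<theta> x \<in> l2 I ip" and \<eta>l2 [simp]: "\<eta> x \<in> l2 I ip" for x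
    using adj_\<theta> adj_\<eta> by (simp_all add: adjointable_l2D)
  have S_eq: "S = adj_l2 I ip \<theta> \<circ> \<theta>"
    unfolding S \<theta> by (rule frame_operator_eq[OF bessel_\<Lambda>])
  have bij_S: "bij S" and adj_invS: "adjointable ip (inv S)"
    unfolding S by (rule bij_frame_operator[OF \<Lambda>], rule adjointable_inv_frame_operator[OF \<Lambda>])
  have \<theta>\<theta> [simp]: "adj_l2 I ip \<theta> (\<theta> (inv S x)) = x" for x
    using surj_f_inv_f[OF bij_is_surj[OF bij_S], of x] by (simp add: S_eq)
  have \<theta>\<eta> [simp]: "adj_l2 I ip \<theta> (\<eta> x) = x" for x
  proof -
    have "((\<lambda>i. adj_H ip (\<Lambda> i) (\<eta> x i)) has_sum adj_l2 I ip \<theta> (\<eta> x)) I"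
      using has_sum_adj_frame_transform[OF bessel_\<Lambda> \<eta>l2] by (simp add: \<theta>)
    also have "?this \<longleftrightarrow> ((\<lambda>i. adj_H ip (\<Lambda> i) (\<Omega> i x)) has_sum adj_l2 I ip \<theta> (\<eta> x)) I"
      by (intro has_sum_cong) (simp add: \<eta> frame_transform_def)
    finally show ?thesis
      using sum_\<Omega> has_sum_unique by blast
  qed
  \<comment> \<open>The adjoint of the identity \<open>\<theta>\<eta>\<close>; it evaluates the
    mixed terms in statement (4).\<close>
  have \<eta>\<theta> [simp]: "adj_l2 I ip \<eta> (\<theta> y) = y" for y
    by (rule adj_unique) (simp add: adjointable_l2D'[OF adj_\<theta>])

  have 1: "adj_l2 I ip \<theta> \<circ> \<eta> = id"
    by auto
  have 2: "\<forall>i\<in>I. \<Omega> i = coord i \<circ> \<eta>"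
    by (auto simp: \<eta> frame_transform_def coord_def)
  have 3: "dual_star_operator_frame I ip \<Lambda> (\<lambda>i. coord i \<circ> \<eta>') \<and>
        frame_transform I (\<lambda>i. coord i \<circ> \<eta>') = \<eta>'"
    if "adjointable_l2 I ip \<eta>'" "adj_l2 I ip \<theta> \<circ> \<eta>' = id" for \<eta>'
    using dual_frame_right_inverse[OF \<Lambda> that(1)] frame_transform_coord[OF \<Lambda> that(1)] that(2) by (simp add: \<theta>)
  have 4: "frame_operator I ip \<Omega> =
      inv S + (adj_l2 I ip \<eta> \<circ> (id - (\<theta> \<circ> inv S \<circ> adj_l2 I ip \<theta>)) \<circ> \<eta>)"
  proof
    fix x
    have "frame_operator I ip \<Omega> x = adj_l2 I ip \<eta> (\<eta> x)"
      by (simp add: frame_operator_eq[OF bessel_\<Omega>] \<eta>)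
    \<comment> \<open>Splitting the adjoint over the difference produces \<open>- inv S x\<close>,
      which cancels the first summand.\<close>
    also have "\<dots> = inv S x + adj_l2 I ip \<eta> (\<eta> x - \<theta> (inv S x))"
      by (simp add: adj_l2_diff[OF adj_\<eta>])
    finally show "frame_operator I ip \<Omega> x =
        (inv S + (adj_l2 I ip \<eta> \<circ> (id - (\<theta> \<circ> inv S \<circ> adj_l2 I ip \<theta>)) \<circ> \<eta>)) x"
      by simp
  qed
  have 5: "\<exists>\<psi>. adjointable_l2 I ip \<psi> \<and>
      \<eta>' = (\<theta> \<circ> inv S) + ((id - (\<theta> \<circ> inv S \<circ> adj_l2 I ip \<theta>)) \<circ> \<psi>)"
    if adj: "adjointable_l2 I ip \<eta>'" and inverse: "adj_l2 I ip \<theta> \<circ> \<eta>' = id" for \<eta>'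
  \<comment> \<open>The witness is \<open>\<eta>'\<close> itself: the adjoint of
    \<open>\<theta>\<close> sends \<open>\<eta>' x\<close> to \<open>x\<close>, so the two
    \<open>\<theta> (inv S x)\<close> terms cancel.\<close>
  proof (intro exI conjI)
    have "adj_l2 I ip \<theta> (\<eta>' x) = x" for x
      using inverse by (metis comp_apply id_apply)
    then show "\<eta>' = (\<theta> \<circ> inv S) + ((id - (\<theta> \<circ> inv S \<circ> adj_l2 I ip \<theta>)) \<circ> \<eta>')"
      by (simp add: fun_eq_iff)
  qed (rule adj)
  have 6: "adjointable_l2 I ip \<eta>' \<and> adj_l2 I ip \<theta> \<circ> \<eta>' = id"
    if \<psi>: "adjointable_l2 I ip \<psi>"
      and \<eta>': "\<eta>' = (\<theta> \<circ> inv S) + ((id - (\<theta> \<circ> inv S \<circ> adj_l2 I ip \<theta>)) \<circ> \<psi>)" for \<psi> \<eta>'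
  proof
    have \<psi>l2: "\<psi> x \<in> l2 I ip" for x
      by (rule adjointable_l2D[OF \<psi>])
    \<comment> \<open>Adjointability is defined only for maps starting from the module, so the
      factors are regrouped to make every composite start there.\<close>
    have eq: "\<eta>' = (\<theta> \<circ> inv S) + (\<psi> - (\<theta> \<circ> (inv S \<circ> (adj_l2 I ip \<theta> \<circ> \<psi>))))"
      by (simp add: \<eta>' fun_eq_iff)
    show "adjointable_l2 I ip \<eta>'"
      unfolding eq by (intro adjointable_l2_add adjointable_l2_diff adjointable_l2_comp
          adjointable_comp adjointable_adj_l2_comp adj_\<theta> adj_invS \<psi>)
    show "adj_l2 I ip \<theta> \<circ> \<eta>' = id"
      by (simp add: eq fun_eq_iff adj_l2_add[OF adj_\<theta>] adj_l2_diff[OF adj_\<theta>] l2_diff \<psi>l2)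
  qed
  \<comment> \<open>With \<open>\<Delta> = \<Omega>\<close>, the bounded map
    \<open>\<Lambda>t i\<close> applied to the reconstruction series gives
    \<open>\<Lambda>t i x\<close>, so the first and last terms cancel.\<close>
  have 7: "(\<lambda>k. \<Lambda>t i (adj_H ip (\<Lambda> k) (\<Omega> k x))) summable_on I \<and>
      \<Omega> i x = \<Lambda>t i x + \<Omega> i x - (\<Sum>\<^sub>\<infinity>k\<in>I. \<Lambda>t i (adj_H ip (\<Lambda> k) (\<Omega> k x)))"
    if i: "i \<in> I" for i x
  proof -
    have "adjointable ip (\<Lambda> i)"
      using \<Lambda> i by (simp add: star_operator_frame_def)
    then have "bounded_linear (\<Lambda>t i)"
      unfolding \<Lambda>t canonical_dual_def S[symmetric]
      by (intro adjointable_bounded_linear adjointable_comp adj_invS)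
    then have "((\<lambda>k. \<Lambda>t i (adj_H ip (\<Lambda> k) (\<Omega> k x))) has_sum \<Lambda>t i x) I"
      using sum_\<Omega> by (rule has_sum_bounded_linear)
    then show ?thesis
      by (simp add: has_sum_imp_summable infsumI)
  qed
  have 8: "\<exists>\<Delta>. star_operator_bessel I ip \<Delta> \<and> frame_transform I \<Delta> = \<eta> \<and>
      (\<forall>i\<in>I. \<forall>x. (\<lambda>k. \<Lambda>t i (adj_H ip (\<Lambda> k) (\<Delta> k x))) summable_on I \<and>
         \<Omega> i x = \<Lambda>t i x + \<Delta> i x - (\<Sum>\<^sub>\<infinity>k\<in>I. \<Lambda>t i (adj_H ip (\<Lambda> k) (\<Delta> k x))))"
    using bessel_\<Omega> 7 \<eta> by blast
  show ?thesis
    using 1 2 3 4 5 6 8 by (intro conjI allI impI) blast+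
qed

end
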